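(* Let $G$ be a connected irregular bipartite graph on $n$ vertices with maximum degree $\Delta$. If $\Delta\ge\lfloor n/2\rfloor$, then $$\rho(G)\le\rho(H_{n,\Delta}),$$ with equality if and only if $G\cong H_{n,\Delta}$.
   Context: Graphs are finite and simple. The spectral radius $\rho(G)$ of a graph $G$ is the largest eigenvalue of its adjacency matrix. A graph is irregular if its vertices do not all have the same degree. $K_{a,b}$ is the complete bipartite graph with parts of sizes $a$ and $b$. The bipartite graph $H_{n,\Delta}$ on $n$ vertices is defined (up to isomorphism) as follows: - if $2\Delta>n$, then $H_{n,\Delta}=K_{\Delta,n-\Delta}$; - if $2\Delta=n$, then $H_{n,\Delta}$ is obtained from $K_{\Delta,\Delta}$ by deleting an edge; - if $2\Delta=n-1$, then $H_{n,\Delta}$ is obtained from $K_{\Delta,\Delta}$ by deleting an edge, and then adding a new vertex and joining it to one vertex of degree less than $\Delta$ (i.e. to one endpoint of the deleted edge). *)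

theory Defs
  imports
    "Jordan_Normal_Form.Spectral_Radius"
    "Graph_Theory.Graph_Theory"
begin

text \<open>
  A finite simple graph is a \<^locale>\<open>pair_graph\<close>: a finite, loop-free, symmetric set of ordered
  pairs over a finite vertex set. An undirected edge is a pair of opposite arcs, so the
  degree of a vertex is its out-degree, and deleting an edge deletes two arcs.
\<close>

definition max_degree :: "'a pair_pre_digraph \<Rightarrow> nat" where
  "max_degree G = Max (out_degree G ` pverts G)"

definition irregular :: "'a pair_pre_digraph \<Rightarrow> bool" where
  "irregular G \<longleftrightarrow> (\<exists>u\<in>pverts G. \<exists>v\<in>pverts G. out_degree G u \<noteq> out_degree G v)"

definition bipartite :: "'a pair_pre_digraph \<Rightarrow> bool" where
  "bipartite G \<longleftrightarrow>
    (\<exists>U V. pverts G = U \<union> V \<and> U \<inter> V = {} \<and> parcs G \<subseteq> U \<times> V \<union> V \<times> U)"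

definition adjacency_matrix_wrt :: "'a list \<Rightarrow> 'a pair_pre_digraph \<Rightarrow> real mat" where
  "adjacency_matrix_wrt vs G =
    mat (length vs) (length vs) (\<lambda>(i, j). if (vs ! i, vs ! j) \<in> parcs G then 1 else 0)"

text \<open>
  The order of the vertices is arbitrary; a different order conjugates the matrix by a permutation
  matrix and hence does not change its eigenvalues.
\<close>

definition adjacency_matrix :: "'a pair_pre_digraph \<Rightarrow> real mat" where
  "adjacency_matrix G =
    adjacency_matrix_wrt (SOME vs. distinct vs \<and> set vs = pverts G) G"

text \<open>
  The matrix is real symmetric, so all its eigenvalues are real and nothing is lost by taking the
  spectrum over the reals. The library constant \<^const>\<open>spectral_radius\<close> is a different notion (the
  largest modulus of a complex eigenvalue).
\<close>

definition graph_spectral_radius :: "'a pair_pre_digraph \<Rightarrow> real" where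
  "graph_spectral_radius G = Max (spectrum (adjacency_matrix G))"

definition complete_bipartite_graph :: "nat \<Rightarrow> nat \<Rightarrow> nat pair_pre_digraph" where
  "complete_bipartite_graph a b =
    \<lparr>pverts = {..<a + b},
     parcs = {..<a} \<times> {a..<a + b} \<union> {a..<a + b} \<times> {..<a}\<rparr>"

lemma complete_bipartite_graph: "K\<^bsub>a,b\<^esub> (with_proj (complete_bipartite_graph a b))"
  unfolding complete_bipartite_digraph_pair_def complete_bipartite_graph_def
  by (intro conjI exI[of _ "{..<a}"] exI[of _ "{a..<a + b}"]) auto

definition delete_edge :: "'a \<Rightarrow> 'a \<Rightarrow> 'a pair_pre_digraph \<Rightarrow> 'a pair_pre_digraph" where
  "delete_edge u v G = \<lparr>pverts = pverts G, parcs = parcs G - {(u, v), (v, u)}\<rparr>"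

definition add_pendant :: "'a \<Rightarrow> 'a \<Rightarrow> 'a pair_pre_digraph \<Rightarrow> 'a pair_pre_digraph" where
  "add_pendant w u G =
    \<lparr>pverts = insert w (pverts G), parcs = parcs G \<union> {(w, u), (u, w)}\<rparr>"

text \<open>
  In \<open>complete_bipartite_graph \<Delta> \<Delta>\<close> the parts are \<open>{..<\<Delta>}\<close> and \<open>{\<Delta>..<2 * \<Delta>}\<close>; the deleted edge
  joins \<open>0\<close> and \<open>\<Delta>\<close>, and \<open>2 * \<Delta>\<close> is a new vertex, joined to the endpoint \<open>0\<close> of the deleted edge.
\<close>

definition extremal_graph :: "nat \<Rightarrow> nat \<Rightarrow> nat pair_pre_digraph" where
  "extremal_graph n \<Delta> =
    (if 2 * \<Delta> > n then complete_bipartite_graph \<Delta> (n - \<Delta>)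
     else if 2 * \<Delta> = n then delete_edge 0 \<Delta> (complete_bipartite_graph \<Delta> \<Delta>)
     else if 2 * \<Delta> + 1 = n then
       add_pendant (2 * \<Delta>) 0 (delete_edge 0 \<Delta> (complete_bipartite_graph \<Delta> \<Delta>))
     else undefined)"

end

theory Submission
  imports Defs
begin

text \<open>
  A positive vector \<open>z\<close> with \<open>A z \<le> \<rho> z\<close> entrywise bounds every eigenvalue of the adjacency matrix \<open>A\<close> by
  \<open>\<rho>\<close>, and on a connected graph \<open>\<rho>\<close> itself is an eigenvalue only if \<open>A z = \<rho> z\<close>. So it suffices to find, for
  the spectral radius \<open>\<rho>\<close> of the extremal graph, such a \<open>z\<close> on \<open>G\<close> for which \<open>A z = \<rho> z\<close> forces an isomorphism.

  Let \<open>U\<close>, \<open>V\<close> be the parts, \<open>|U| \<le> |V|\<close>, so that \<open>\<Delta> \<le> |V|\<close>. If \<open>2\<Delta> > n\<close>, or if \<open>|U| < \<Delta>\<close>, a vector that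
  is constant on each part works. If \<open>|U| = |V| = \<Delta>\<close>, irregularity gives a non-adjacent pair in \<open>U \<times> V\<close>, and
  the Perron vector of \<open>K\<^bsub>\<Delta>,\<Delta>\<^esub>\<close> minus that edge works. If \<open>|U| = \<Delta>\<close> and \<open>|V| = \<Delta> + 1\<close>, every \<open>u \<in> U\<close> misses some
  \<open>f u \<in> V\<close>; with \<open>c v\<close> the size of the fibre of \<open>f\<close> over \<open>v\<close> and \<open>r = \<rho>\<^sup>2\<close>, take \<open>z u = 1 / (r - c (f u))\<close> on \<open>U\<close> and on \<open>V\<close>
  the sum of \<open>z\<close> over the \<open>u\<close> with \<open>f u \<noteq> v\<close>, divided by \<open>\<rho>\<close>. The requirement becomes
  \<open>(\<Delta> - 1) (\<Sum>v. c v / (r - c v)) \<le> 1\<close>, which holds because \<open>x / (r - x)\<close> is convex and \<open>f\<close> is not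
  constant; the extreme case is that of two fibres of sizes \<open>1\<close> and \<open>\<Delta> - 1\<close>, which is the extremal graph.
\<close>

section \<open>Eigenvalues of graphs\<close>

text \<open>A complex eigenvector \<open>a + i b\<close> exists, and symmetry equates the pairing of
  \<open>b\<close> with \<open>A a\<close> and that of \<open>a\<close> with \<open>A b\<close>.
  This forces the eigenvalue to be real, so \<open>a\<close> or \<open>b\<close> is a real
  eigenvector. It gives the \<open>Max\<close> in \<open>graph_spectral_radius\<close> a nonempty
  set.\<close>

lemma symmetric_real_mat_spectrum_nonempty:
  fixes A :: "real mat"
  assumes A: "A \<in> carrier_mat n n" and n: "n > 0"
    and sym: "\<And>i j. i < n \<Longrightarrow> j < n \<Longrightarrow> A $$ (i, j) = A $$ (j, i)"
  shows "spectrum A \<noteq> {}"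
proof -
  let ?C = "map_mat complex_of_real A"
  have C: "?C \<in> carrier_mat n n" using A by simp
  obtain \<mu> v where v: "v \<in> carrier_vec n" "v \<noteq> 0\<^sub>v n" "?C *\<^sub>v v = \<mu> \<cdot>\<^sub>v v"
    using spectrum_non_empty[OF C n] C by (auto simp: spectrum_def eigenvalue_def eigenvector_def)
  define a b where "a = (\<lambda>i. Re (v $ i))" and "b = (\<lambda>i. Im (v $ i))"
  have row: "(\<Sum>j<n. complex_of_real (A $$ (i, j)) * v $ j) = \<mu> * v $ i" if "i < n" for i
  proof -
    have "(?C *\<^sub>v v) $ i = (\<Sum>j<n. complex_of_real (A $$ (i, j)) * v $ j)"
      using that A v(1) by (auto simp: scalar_prod_def lessThan_atLeast0 intro!: sum.cong)
    then show ?thesis using v that by auto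
  qed
  have Aa: "(\<Sum>j<n. A $$ (i, j) * a j) = Re \<mu> * a i - Im \<mu> * b i" if "i < n" for i
    using arg_cong[OF row[OF that], of Re] by (simp add: a_def b_def)
  have Ab: "(\<Sum>j<n. A $$ (i, j) * b j) = Re \<mu> * b i + Im \<mu> * a i" if "i < n" for i
    using arg_cong[OF row[OF that], of Im] by (simp add: a_def b_def)
  obtain k where k: "k < n" "v $ k \<noteq> 0"
    using v(1,2) by (metis carrier_vecD eq_vecI index_zero_vec)
  then have ab: "a k \<noteq> 0 \<or> b k \<noteq> 0" by (simp add: a_def b_def complex_eq_iff)
  have "(\<Sum>i<n. b i * (\<Sum>j<n. A $$ (i, j) * a j)) = (\<Sum>i<n. \<Sum>j<n. A $$ (i, j) * b i * a j)"
    by (simp add: sum_distrib_left mult_ac)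
  also have "\<dots> = (\<Sum>j<n. \<Sum>i<n. A $$ (i, j) * b i * a j)" by (rule sum.swap)
  also have "\<dots> = (\<Sum>i<n. a i * (\<Sum>j<n. A $$ (i, j) * b j))"
    unfolding sum_distrib_left by (intro sum.cong refl) (simp add: sym mult_ac)
  finally have "(\<Sum>i<n. b i * (Re \<mu> * a i - Im \<mu> * b i)) = (\<Sum>i<n. a i * (Re \<mu> * b i + Im \<mu> * a i))"
    by (simp add: Aa Ab)
  then have "Im \<mu> * (\<Sum>i<n. a i ^ 2 + b i ^ 2) = 0"
    by (simp add: algebra_simps sum_subtractf sum.distrib sum_distrib_left power2_eq_square)
  moreover have "(\<Sum>i<n. a i ^ 2 + b i ^ 2) > 0"
    using k ab by (intro sum_pos2[of _ k]) (auto simp: add_pos_nonneg add_nonneg_pos)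
  ultimately have im: "Im \<mu> = 0" by simp
  have *: "eigenvalue A (Re \<mu>)"
    if c: "\<And>i. i < n \<Longrightarrow> (\<Sum>j<n. A $$ (i, j) * c j) = Re \<mu> * c i" "c k \<noteq> 0" for c
  proof -
    have "A *\<^sub>v vec n c = Re \<mu> \<cdot>\<^sub>v vec n c"
    proof (rule eq_vecI)
      fix i assume i: "i < dim_vec (Re \<mu> \<cdot>\<^sub>v vec n c)"
      then have "(A *\<^sub>v vec n c) $ i = (\<Sum>j<n. A $$ (i, j) * c j)"
        using A by (auto simp: scalar_prod_def lessThan_atLeast0 intro!: sum.cong)
      then show "(A *\<^sub>v vec n c) $ i = (Re \<mu> \<cdot>\<^sub>v vec n c) $ i" using c i by simp
    qed (use A in auto)
    moreover have "vec n c \<noteq> 0\<^sub>v n" using k(1) c(2) by (metis index_vec index_zero_vec(1))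
    ultimately show ?thesis
      unfolding eigenvalue_def eigenvector_def using A by (intro exI[of _ "vec n c"]) auto
  qed
  have "eigenvalue A (Re \<mu>)" using ab *[of a] *[of b] Aa Ab im by auto
  then show ?thesis by (auto simp: spectrum_def)
qed

text \<open>Eigenvectors become functions on the vertices, so the arbitrary vertex order behind
  \<open>adjacency_matrix\<close> disappears. The relational image of \<open>{i}\<close> is the
  neighbourhood of \<open>i\<close>.\<close>

definition graph_eigenvalue :: "'a pair_pre_digraph \<Rightarrow> real \<Rightarrow> bool" where
  "graph_eigenvalue G k \<longleftrightarrow>
    (\<exists>x. (\<exists>i\<in>pverts G. x i \<noteq> 0) \<and> (\<forall>i\<in>pverts G. (\<Sum>j\<in>parcs G `` {i}. x j) = k * x i))"

lemma eigenvalue_adjacency_matrix_wrt: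
  assumes G: "pair_fin_digraph G" and vs: "distinct vs" "set vs = pverts G"
  shows "eigenvalue (adjacency_matrix_wrt vs G) k \<longleftrightarrow> graph_eigenvalue G k"
proof -
  interpret pair_fin_digraph G by fact
  let ?n = "length vs" and ?A = "adjacency_matrix_wrt vs G"
  have bij: "bij_betw ((!) vs) {..<?n} (pverts G)"
    using vs bij_betw_nth by blast
  have row: "(?A *\<^sub>v vec ?n (\<lambda>i. x (vs ! i))) $ i = (\<Sum>j\<in>parcs G `` {vs ! i}. x j)"
    if "i < ?n" for x i
  proof -
    have "(?A *\<^sub>v vec ?n (\<lambda>i. x (vs ! i))) $ i =
        (\<Sum>j<?n. (if (vs ! i, vs ! j) \<in> parcs G then 1 else 0) * x (vs ! j))"
      using that by (auto simp: adjacency_matrix_wrt_def scalar_prod_def lessThan_atLeast0 intro!: sum.cong)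
    also have "\<dots> = (\<Sum>w\<in>pverts G. (if (vs ! i, w) \<in> parcs G then 1 else 0) * x w)"
      by (rule sum.reindex_bij_betw[OF bij])
    also have "\<dots> = (\<Sum>w\<in>parcs G `` {vs ! i}. x w)"
      by (rule sum.mono_neutral_cong_right) (auto dest: arc_snd_in_verts)
    finally show ?thesis .
  qed
  have dims: "dim_row ?A = ?n" "dim_col ?A = ?n" by (auto simp: adjacency_matrix_wrt_def)
  show ?thesis
  proof
    assume "eigenvalue ?A k"
    then obtain v where v: "v \<in> carrier_vec ?n" "v \<noteq> 0\<^sub>v ?n" "?A *\<^sub>v v = k \<cdot>\<^sub>v v"
      by (auto simp: eigenvalue_def eigenvector_def dims)
    \<comment> \<open>The vector \<open>v\<close> is transported to the vertices along the
      enumeration \<open>vs\<close>.\<close>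
    define x where "x w = v $ the_inv_into {..<?n} ((!) vs) w" for w
    have x: "x (vs ! i) = v $ i" if "i < ?n" for i
      using that bij by (simp add: x_def bij_betw_def the_inv_into_f_f)
    have vx: "v = vec ?n (\<lambda>i. x (vs ! i))" using v(1) by (intro eq_vecI) (auto simp: x)
    obtain i where "i < ?n" "v $ i \<noteq> 0" using v(1,2) by (metis carrier_vecD eq_vecI index_zero_vec)
    then have "\<exists>i\<in>pverts G. x i \<noteq> 0" using vs x by (metis nth_mem)
    moreover have "(\<Sum>j\<in>parcs G `` {w}. x j) = k * x w" if w: "w \<in> pverts G" for w
    proof -
      obtain i where i: "i < ?n" "w = vs ! i"
        using w[folded vs(2)] by (auto simp: in_set_conv_nth)
      have "(?A *\<^sub>v v) $ i = (k \<cdot>\<^sub>v v) $ i" using v(3) by simp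
      then show ?thesis using row[OF i(1), of x] i x[OF i(1)] v(1) by (simp flip: vx)
    qed
    ultimately show "graph_eigenvalue G k" unfolding graph_eigenvalue_def by blast
  next
    assume "graph_eigenvalue G k"
    then obtain x where x: "\<exists>i\<in>pverts G. x i \<noteq> 0"
      "\<And>i. i\<in>pverts G \<Longrightarrow> (\<Sum>j\<in>parcs G `` {i}. x j) = k * x i"
      unfolding graph_eigenvalue_def by blast
    let ?v = "vec ?n (\<lambda>i. x (vs ! i))"
    obtain i where "i < ?n" "x (vs ! i) \<noteq> 0" using x(1) vs by (metis in_set_conv_nth)
    then have "?v \<noteq> 0\<^sub>v ?n" by (metis index_vec index_zero_vec(1))
    moreover have "?A *\<^sub>v ?v = k \<cdot>\<^sub>v ?v"
    proof (rule eq_vecI)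
      fix i assume "i < dim_vec (k \<cdot>\<^sub>v ?v)"
      then have i: "i < ?n" by simp
      then have "vs ! i \<in> pverts G" using vs nth_mem by blast
      then show "(?A *\<^sub>v ?v) $ i = (k \<cdot>\<^sub>v ?v) $ i" using row[OF i, of x] x(2) i by simp
    qed (simp add: dims)
    ultimately show "eigenvalue ?A k"
      unfolding eigenvalue_def eigenvector_def dims by (intro exI[of _ ?v]) auto
  qed
qed

lemma pair_graph_arc_sym:
  assumes "pair_graph G" "(u, v) \<in> parcs G"
  shows "(v, u) \<in> parcs G"
proof -
  interpret pair_graph G by fact
  show ?thesis using assms(2) sym_arcs by (simp add: symmetric_def sym_def)
qed

text \<open>The spectrum is finite and, by symmetry of the matrix, nonempty, so \<open>Max\<close>
  is attained. Everything later about the spectral radius rests on these two facts.\<close>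

lemma graph_spectral_radius_is_Max:
  assumes G: "pair_graph G" and ne: "pverts G \<noteq> {}"
  shows "graph_eigenvalue G (graph_spectral_radius G)"
    and "graph_eigenvalue G k \<Longrightarrow> k \<le> graph_spectral_radius G"
proof -
  interpret pair_graph G by fact
  define vs where "vs = (SOME vs. distinct vs \<and> set vs = pverts G)"
  have vs: "distinct vs" "set vs = pverts G"
    using someI_ex[of "\<lambda>vs. distinct vs \<and> set vs = pverts G"]
      finite_distinct_list[of "pverts G"] pair_finite_verts unfolding vs_def by blast+
  let ?A = "adjacency_matrix_wrt vs G"
  have A: "?A \<in> carrier_mat (length vs) (length vs)" by (simp add: adjacency_matrix_wrt_def)
  have spec: "spectrum ?A = Collect (graph_eigenvalue G)"
    using eigenvalue_adjacency_matrix_wrt[OF _ vs] pair_fin_digraph by (auto simp: spectrum_def)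
  have fin: "finite (spectrum ?A)" by (rule card_finite_spectrum[OF A])
  have nonempty: "spectrum ?A \<noteq> {}"
    by (rule symmetric_real_mat_spectrum_nonempty[OF A])
      (use vs ne pair_graph_arc_sym[OF G] in \<open>auto simp: adjacency_matrix_wrt_def\<close>)
  have r: "graph_spectral_radius G = Max (Collect (graph_eigenvalue G))"
    by (simp add: graph_spectral_radius_def adjacency_matrix_def flip: vs_def spec)
  show "graph_eigenvalue G (graph_spectral_radius G)"
    using Max_in[OF fin nonempty] unfolding r spec by simp
  show "k \<le> graph_spectral_radius G" if "graph_eigenvalue G k"
    using Max_ge[OF fin, of k] that unfolding r spec by simp
qed

text \<open>For an eigenvector \<open>x\<close>, scale \<open>z\<close> by the least
  \<open>M\<close> with |x| \<le> M z. At a vertex where the two touch, the eigenvalue equation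
  gives k M z \<le> r M z. If \<open>k = r\<close>, equality there makes all neighbours touch as
  well, and connectivity carries this to every vertex.\<close>

lemma graph_eigenvalue_le_supersolution:
  assumes G: "pair_fin_digraph G"
    and pos: "\<And>i. i \<in> pverts G \<Longrightarrow> 0 < z i"
    and le: "\<And>i. i \<in> pverts G \<Longrightarrow> (\<Sum>j\<in>parcs G `` {i}. z j) \<le> r * z i"
    and ev: "graph_eigenvalue G k"
  shows "k \<le> r"
    and "Digraph_Component.connected (with_proj G) \<Longrightarrow> symmetric (with_proj G) \<Longrightarrow> k = r \<Longrightarrow>
      i \<in> pverts G \<Longrightarrow> (\<Sum>j\<in>parcs G `` {i}. z j) = r * z i"
proof -
  interpret pair_fin_digraph G by fact
  obtain x where x: "\<exists>i\<in>pverts G. x i \<noteq> 0"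
    "\<And>i. i \<in> pverts G \<Longrightarrow> (\<Sum>j\<in>parcs G `` {i}. x j) = k * x i"
    using ev unfolding graph_eigenvalue_def by blast
  have fin: "finite (pverts G)" by (rule pair_finite_verts)
  define M where "M = Max ((\<lambda>i. \<bar>x i\<bar> / z i) ` pverts G)"
  have "M \<in> (\<lambda>i. \<bar>x i\<bar> / z i) ` pverts G" unfolding M_def using fin x(1) by (intro Max_in) auto
  then obtain m where m: "m \<in> pverts G" "\<bar>x m\<bar> = M * z m" using pos by (force simp: field_simps)
  have M: "\<bar>x i\<bar> \<le> M * z i" if "i \<in> pverts G" for i
  proof -
    have "\<bar>x i\<bar> / z i \<le> M" unfolding M_def using that fin by (intro Max_ge) auto
    then show ?thesis using pos[OF that] by (simp add: pos_divide_le_eq)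
  qed
  obtain i0 where i0: "i0 \<in> pverts G" "x i0 \<noteq> 0" using x(1) by blast
  then have "0 < M * z i0" using M[OF i0(1)] by linarith
  then have Mpos: "0 < M" using pos[OF i0(1)] by (simp add: zero_less_mult_iff)
  have nb: "j \<in> pverts G" if "j \<in> parcs G `` {i}" for i j using that by (auto dest: arc_snd_in_verts)
  have nbfin: "finite (parcs G `` {i})" for i using fin nb by (meson finite_subset subsetI)
  have chain: "k * \<bar>x i\<bar> \<le> (\<Sum>j\<in>parcs G `` {i}. \<bar>x j\<bar>)"
    "(\<Sum>j\<in>parcs G `` {i}. \<bar>x j\<bar>) \<le> M * (\<Sum>j\<in>parcs G `` {i}. z j)"
    "M * (\<Sum>j\<in>parcs G `` {i}. z j) \<le> M * (r * z i)" if "i \<in> pverts G" for i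
  proof -
    have "k * \<bar>x i\<bar> \<le> \<bar>k * x i\<bar>" by (simp add: abs_mult mult_right_mono)
    also have "\<dots> \<le> (\<Sum>j\<in>parcs G `` {i}. \<bar>x j\<bar>)" unfolding x(2)[OF that, symmetric] by (rule sum_abs)
    finally show "k * \<bar>x i\<bar> \<le> (\<Sum>j\<in>parcs G `` {i}. \<bar>x j\<bar>)" .
    show "(\<Sum>j\<in>parcs G `` {i}. \<bar>x j\<bar>) \<le> M * (\<Sum>j\<in>parcs G `` {i}. z j)"
      unfolding sum_distrib_left using nb M by (intro sum_mono) blast
    show "M * (\<Sum>j\<in>parcs G `` {i}. z j) \<le> M * (r * z i)" using le[OF that] Mpos by simp
  qed
  show "k \<le> r"
  proof -
    have "k * (M * z m) \<le> r * (M * z m)" using chain[OF m(1)] m(2) by (simp add: mult_ac)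
    then show ?thesis using Mpos pos[OF m(1)] by simp
  qed
  assume con: "Digraph_Component.connected (with_proj G)" and sym: "symmetric (with_proj G)"
    and k: "k = r" and i: "i \<in> pverts G"
  have tight: "(\<Sum>j\<in>parcs G `` {i}. \<bar>x j\<bar>) = M * (\<Sum>j\<in>parcs G `` {i}. z j)"
    "(\<Sum>j\<in>parcs G `` {i}. z j) = r * z i" if "i \<in> pverts G" "\<bar>x i\<bar> = M * z i" for i
  proof -
    have "M * (r * z i) = k * \<bar>x i\<bar>" using that(2) k by simp
    then have "M * (\<Sum>j\<in>parcs G `` {i}. z j) = M * (r * z i)"
      and "(\<Sum>j\<in>parcs G `` {i}. \<bar>x j\<bar>) = M * (\<Sum>j\<in>parcs G `` {i}. z j)"
      using chain[OF that(1)] by linarith+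
    then show "(\<Sum>j\<in>parcs G `` {i}. \<bar>x j\<bar>) = M * (\<Sum>j\<in>parcs G `` {i}. z j)"
      "(\<Sum>j\<in>parcs G `` {i}. z j) = r * z i" using Mpos by simp_all
  qed
  have tight_step: "\<bar>x j\<bar> = M * z j" if "i \<in> pverts G" "\<bar>x i\<bar> = M * z i" "(i, j) \<in> parcs G" for i j
  proof (rule ccontr)
    assume "\<bar>x j\<bar> \<noteq> M * z j"
    then have "\<bar>x j\<bar> < M * z j" using M[of j] nb[of j i] that by auto
    then have "(\<Sum>j\<in>parcs G `` {i}. \<bar>x j\<bar>) < (\<Sum>j\<in>parcs G `` {i}. M * z j)"
      using that(3) nbfin nb M by (intro sum_strict_mono_ex1) blast+
    then show False using tight(1)[OF that(1,2)] by (simp add: sum_distrib_left)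
  qed
  have "strongly_connected (with_proj G)"
    using symmetric_connected_imp_strongly_connected[OF sym con] .
  then have "m \<rightarrow>\<^sup>*\<^bsub>with_proj G\<^esub> i" using m i by (auto simp: strongly_connected_def)
  then have "\<bar>x i\<bar> = M * z i"
  proof (induction rule: reachable_induct)
    case base
    show ?case using m by simp
  next
    case (step j l)
    show ?case using step tight_step[of j l] reachable_in_verts(2) by auto
  qed
  then show "(\<Sum>j\<in>parcs G `` {i}. z j) = r * z i" using tight i by blast
qed

text \<open>A positive eigenvector is a supersolution with equality, so its eigenvalue bounds all
  others.\<close>

lemma graph_spectral_radius_eqI:
  assumes G: "pair_graph G" and ne: "pverts G \<noteq> {}"
    and pos: "\<And>i. i \<in> pverts G \<Longrightarrow> 0 < z i"
    and eq: "\<And>i. i \<in> pverts G \<Longrightarrow> (\<Sum>j\<in>parcs G `` {i}. z j) = r * z i"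
  shows "graph_spectral_radius G = r"
proof (rule antisym)
  interpret pair_graph G by fact
  show "graph_spectral_radius G \<le> r"
    by (rule graph_eigenvalue_le_supersolution(1)[OF pair_fin_digraph pos eq_refl[OF eq]
        graph_spectral_radius_is_Max(1)[OF G ne]])
  have "graph_eigenvalue G r"
    unfolding graph_eigenvalue_def using ne pos eq by (intro exI[of _ z]) (auto simp: less_le)
  then show "r \<le> graph_spectral_radius G" by (rule graph_spectral_radius_is_Max(2)[OF G ne])
qed

text \<open>Composition with the vertex map of the isomorphism carries eigenvectors of
  \<open>H\<close> to eigenvectors of \<open>G\<close>, and its inverse carries them back; the
  eigenvalues agree.\<close>

lemma digraph_iso_imp_graph_spectral_radius_eq:
  assumes iso: "digraph_iso (with_proj G) (with_proj H)"
    and G: "pair_graph G" and H: "pair_graph H" and ne: "pverts G \<noteq> {}"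
  shows "graph_spectral_radius G = graph_spectral_radius H"
proof -
  interpret pair_graph G by fact
  obtain f where f: "digraph_isomorphism f" "with_proj H = app_iso f (with_proj G)"
    using iso by (auto simp: digraph_iso_def)
  let ?p = "iso_verts f"
  have inj: "inj_on ?p (pverts G)" using digraph_isomorphism_inj_on_verts[OF f(1)] .
  have verts: "pverts H = ?p ` pverts G"
    using arg_cong[OF f(2), of verts] by simp
  \<comment> \<open>The tail and head maps of \<open>with_proj H\<close> are the projections; hence
    on arcs \<open>f\<close> is determined by its vertex map.\<close>
  have tail: "iso_tail f = fst" and head: "iso_head f = snd"
    using arg_cong[OF f(2), of tail] arg_cong[OF f(2), of head] by simp_all
  have arc: "iso_arcs f a = (?p (fst a), ?p (snd a))" if "a \<in> parcs G" for a
    using iso_verts_tail[OF f(1), of a] iso_verts_head[OF f(1), of a] that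
    by (simp add: tail head prod_eq_iff)
  have arcs: "parcs H = (\<lambda>a. (?p (fst a), ?p (snd a))) ` parcs G"
    using arg_cong[OF f(2), of arcs] arc by simp
  have nb: "parcs H `` {?p i} = ?p ` (parcs G `` {i})" if "i \<in> pverts G" for i
  proof (intro subset_antisym subsetI)
    fix w assume "w \<in> parcs H `` {?p i}"
    then obtain a where a: "a \<in> parcs G" "?p i = ?p (fst a)" "w = ?p (snd a)"
      unfolding arcs by auto
    then have "fst a = i" using inj_onD[OF inj a(2) that] arc_fst_in_verts by simp
    then show "w \<in> ?p ` (parcs G `` {i})" using a by (cases a) auto
  next
    fix w assume "w \<in> ?p ` (parcs G `` {i})"
    then show "w \<in> parcs H `` {?p i}" unfolding arcs by force
  qed
  have sum: "(\<Sum>j\<in>parcs H `` {?p i}. x j) = (\<Sum>j\<in>parcs G `` {i}. x (?p j))"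
    if "i \<in> pverts G" for i and x :: "_ \<Rightarrow> real"
    unfolding nb[OF that]
    by (subst sum.reindex) (auto intro!: inj_on_subset[OF inj] dest: arc_snd_in_verts)
  have "graph_eigenvalue G k \<longleftrightarrow> graph_eigenvalue H k" for k
  proof
    assume "graph_eigenvalue H k"
    then obtain x where "\<exists>i\<in>pverts H. x i \<noteq> 0"
      "\<forall>i\<in>pverts H. (\<Sum>j\<in>parcs H `` {i}. x j) = k * x i" by (auto simp: graph_eigenvalue_def)
    then show "graph_eigenvalue G k"
      unfolding graph_eigenvalue_def verts by (intro exI[of _ "\<lambda>i. x (?p i)"]) (auto simp: sum)
  next
    assume "graph_eigenvalue G k"
    then obtain x where x: "\<exists>i\<in>pverts G. x i \<noteq> 0"
      "\<forall>i\<in>pverts G. (\<Sum>j\<in>parcs G `` {i}. x j) = k * x i" by (auto simp: graph_eigenvalue_def)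
    define y where "y w = x (the_inv_into (pverts G) ?p w)" for w
    have y: "y (?p i) = x i" if "i \<in> pverts G" for i
      using that inj by (simp add: y_def the_inv_into_f_f)
    have "(\<Sum>j\<in>parcs G `` {i}. y (?p j)) = (\<Sum>j\<in>parcs G `` {i}. x j)" for i
      by (intro sum.cong) (auto simp: y dest: arc_snd_in_verts)
    then show "graph_eigenvalue H k"
      unfolding graph_eigenvalue_def verts using x by (intro exI[of _ y]) (auto simp: sum y)
  qed
  then show ?thesis
    using graph_spectral_radius_is_Max[OF G ne] graph_spectral_radius_is_Max[OF H] ne verts
    by (intro antisym) auto
qed

section \<open>Isomorphisms from vertex bijections, and the comparison principle\<close>

lemma digraph_iso_imageI:
  assumes G: "pair_wf_digraph G" and inj: "inj_on p (pverts G)" and verts: "pverts H = p ` pverts G"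
    and arcs: "parcs H = (\<lambda>(u, v). (p u, p v)) ` parcs G"
  shows "digraph_iso (with_proj G) (with_proj H)"
proof -
  interpret pair_wf_digraph G by fact
  let ?f = "\<lparr>iso_verts = p, iso_arcs = (\<lambda>(u, v). (p u, p v)), iso_head = snd, iso_tail = fst\<rparr>"
  have "inj_on (\<lambda>(u, v). (p u, p v)) (parcs G)"
    by (rule inj_on_subset[OF map_prod_inj_on[OF inj inj, unfolded map_prod_def]])
      (use arc_fst_in_verts arc_snd_in_verts in force)
  then have "digraph_isomorphism ?f"
    unfolding digraph_isomorphism_def using inj wf_digraph by (auto split: prod.splits)
  moreover have "with_proj H = app_iso ?f (with_proj G)"
    by (simp add: app_iso_def with_proj_def verts arcs)
  ultimately show ?thesis unfolding digraph_iso_def by blast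
qed

lemma digraph_iso_bijI:
  assumes G: "pair_wf_digraph G" and H: "pair_wf_digraph H" and p: "bij_betw p (pverts G) (pverts H)"
    and arcs: "\<And>u v. u \<in> pverts G \<Longrightarrow> v \<in> pverts G \<Longrightarrow> (p u, p v) \<in> parcs H \<longleftrightarrow> (u, v) \<in> parcs G"
  shows "digraph_iso (with_proj G) (with_proj H)"
proof (rule digraph_iso_imageI[OF G])
  interpret G: pair_wf_digraph G by fact
  interpret H: pair_wf_digraph H by fact
  show "inj_on p (pverts G)" and verts: "pverts H = p ` pverts G"
    using p by (auto simp: bij_betw_def)
  show "parcs H = (\<lambda>(u, v). (p u, p v)) ` parcs G"
  proof (intro subset_antisym subsetI)
    fix e assume e: "e \<in> parcs H"
    then obtain u v where "u \<in> pverts G" "v \<in> pverts G" "e = (p u, p v)"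
      using H.arc_fst_in_verts[OF e] H.arc_snd_in_verts[OF e] verts by (metis imageE prod.collapse)
    then show "e \<in> (\<lambda>(u, v). (p u, p v)) ` parcs G" using e arcs[of u v] by (auto intro!: image_eqI[of _ _ "(u, v)"])
  next
    fix e assume "e \<in> (\<lambda>(u, v). (p u, p v)) ` parcs G"
    then obtain u v where "(u, v) \<in> parcs G" "e = (p u, p v)" by auto
    then show "e \<in> parcs H" using arcs[of u v] G.arc_fst_in_verts G.arc_snd_in_verts by fastforce
  qed
qed

text \<open>The common frame of all cases: a positive supersolution for the radius of
  \<open>H\<close> gives the inequality, equal radii make it an exact solution on the connected
  graph \<open>G\<close>, and the converse is invariance under isomorphism.\<close>

lemma graph_spectral_radius_comparison:
  assumes G: "pair_graph G" and con: "Digraph_Component.connected (with_proj G)" and H: "pair_graph H"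
    and pos: "\<And>i. i \<in> pverts G \<Longrightarrow> 0 < z i"
    and le: "\<And>i. i \<in> pverts G \<Longrightarrow> (\<Sum>j\<in>parcs G `` {i}. z j) \<le> graph_spectral_radius H * z i"
    and iso: "(\<And>i. i \<in> pverts G \<Longrightarrow> (\<Sum>j\<in>parcs G `` {i}. z j) = graph_spectral_radius H * z i) \<Longrightarrow>
      digraph_iso (with_proj G) (with_proj H)"
  shows "graph_spectral_radius G \<le> graph_spectral_radius H \<and>
    (graph_spectral_radius G = graph_spectral_radius H \<longleftrightarrow> digraph_iso (with_proj G) (with_proj H))"
proof -
  interpret pair_graph G by fact
  have ne: "pverts G \<noteq> {}" using con by (auto simp: connected_conv)
  note cmp = graph_eigenvalue_le_supersolution[OF pair_fin_digraph pos le
      graph_spectral_radius_is_Max(1)[OF G ne]]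
  have "graph_spectral_radius G \<le> graph_spectral_radius H" using cmp(1) .
  moreover have "digraph_iso (with_proj G) (with_proj H)" if "graph_spectral_radius G = graph_spectral_radius H"
    using cmp(2)[OF _ _ con _ that] iso sym_arcs by blast
  ultimately show ?thesis using digraph_iso_imp_graph_spectral_radius_eq[OF _ G H ne] by blast
qed

section \<open>Degrees and neighbourhoods in pair graphs\<close>

lemma pair_graphI:
  assumes "finite (pverts G)" "parcs G \<subseteq> pverts G \<times> pverts G" "sym (parcs G)" "irrefl (parcs G)"
  shows "pair_graph G"
proof
  show "finite (parcs G)" using assms(1,2) finite_subset by blast
qed (use assms in \<open>auto simp: symmetric_def irrefl_def\<close>)

lemma out_degree_eq_card_Image: "out_degree (with_proj G) u = card (parcs G `` {u})"
proof -
  have "out_arcs (with_proj G) u = Pair u ` (parcs G `` {u})" by (auto simp: out_arcs_def)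
  then show ?thesis by (simp add: out_degree_def card_image inj_on_def)
qed

lemma connected_imp_neighbour:
  assumes G: "pair_graph G" and con: "Digraph_Component.connected (with_proj G)"
    and v: "v \<in> pverts G" and w: "w \<in> pverts G" "w \<noteq> v"
  shows "parcs G `` {v} \<noteq> {}"
proof -
  interpret pair_graph G by fact
  have "strongly_connected (with_proj G)"
    using symmetric_connected_imp_strongly_connected[OF sym_arcs con] .
  then have "v \<rightarrow>\<^sup>*\<^bsub>with_proj G\<^esub> w" using v w by (auto simp: strongly_connected_def)
  then show ?thesis using w(2) by (cases rule: converse_reachable_cases) auto
qed

section \<open>Blow-ups and the extremal graphs\<close>

text \<open>\<open>R\<close> and \<open>s\<close> fix the graph up to isomorphism, which reduces
  isomorphism proofs to counting colour classes. Vectors constant on classes reduce the eigenvalue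
  equations to the quotient matrix.\<close>

definition blow_up :: "(nat \<Rightarrow> nat \<Rightarrow> bool) \<Rightarrow> (nat \<Rightarrow> nat) \<Rightarrow> ('a \<Rightarrow> nat) \<Rightarrow> 'a pair_pre_digraph \<Rightarrow> bool" where
  "blow_up R s c G \<longleftrightarrow>
    (\<forall>u\<in>pverts G. \<forall>v\<in>pverts G. (u, v) \<in> parcs G \<longleftrightarrow> R (c u) (c v)) \<and>
    (\<forall>l. card {u \<in> pverts G. c u = l} = s l)"

text \<open>Classes with the same label have the same size, so bijections between them glue to a
  vertex bijection that preserves labels and hence adjacency.\<close>

lemma blow_up_iso:
  assumes G: "pair_graph G" "blow_up R s c G" and H: "pair_graph H" "blow_up R s c' H"
  shows "digraph_iso (with_proj G) (with_proj H)"
proof -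
  interpret G: pair_graph G by fact
  interpret H: pair_graph H by fact
  have "\<exists>f. bij_betw f {u \<in> pverts G. c u = l} {u \<in> pverts H. c' u = l}" for l
    using G(2) H(2) G.pair_finite_verts H.pair_finite_verts
    by (intro finite_same_card_bij) (auto simp: blow_up_def)
  then obtain f where f: "bij_betw (f l) {u \<in> pverts G. c u = l} {u \<in> pverts H. c' u = l}" for l
    by metis
  define p where "p u = f (c u) u" for u
  have p: "p u \<in> pverts H" "c' (p u) = c u" if "u \<in> pverts G" for u
    using bij_betwE[OF f[of "c u"]] that by (auto simp: p_def)
  have "bij_betw p (pverts G) (pverts H)"
  proof (rule bij_betw_imageI)
    show "inj_on p (pverts G)"
    proof (rule inj_onI)
      fix u v assume uv: "u \<in> pverts G" "v \<in> pverts G" "p u = p v"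
      then have "c u = c v" using p by metis
      then show "u = v" using uv bij_betw_imp_inj_on[OF f[of "c u"]] by (simp add: p_def inj_on_def)
    qed
    show "p ` pverts G = pverts H"
    proof (intro subset_antisym subsetI)
      fix w assume "w \<in> pverts H"
      then have "w \<in> f (c' w) ` {u \<in> pverts G. c u = c' w}"
        using f[of "c' w"] by (simp add: bij_betw_def)
      then obtain x where "x \<in> pverts G" "c x = c' w" "w = f (c' w) x" by auto
      then show "w \<in> p ` pverts G" by (intro image_eqI[of _ _ x]) (simp_all add: p_def)
    qed (use p in auto)
  qed
  then show ?thesis
    using G(2) H(2) p
    by (intro digraph_iso_bijI[OF G.pair_wf_digraph H.pair_wf_digraph]) (auto simp: blow_up_def)
qed

text \<open>Grouping the neighbours by class yields a row of the quotient matrix: the classes form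
  an equitable partition.\<close>

lemma blow_up_sum_neighbours:
  fixes y :: "nat \<Rightarrow> real"
  assumes G: "pair_graph G" "blow_up R s c G" and i: "i \<in> pverts G"
    and m: "\<And>u. u \<in> pverts G \<Longrightarrow> c u < m"
  shows "(\<Sum>j\<in>parcs G `` {i}. y (c j)) = (\<Sum>l<m. if R (c i) l then real (s l) * y l else 0)"
proof -
  interpret pair_graph G by fact
  have nb: "parcs G `` {i} = {u \<in> pverts G. R (c i) (c u)}"
    using G(2) i arc_snd_in_verts by (fastforce simp: blow_up_def)
  have fin: "finite (parcs G `` {i})" unfolding nb using pair_finite_verts by simp
  have "(\<Sum>j\<in>parcs G `` {i}. y (c j)) = (\<Sum>l<m. \<Sum>j\<in>{j \<in> parcs G `` {i}. c j = l}. y (c j))"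
    by (rule sum.group[symmetric]) (use fin nb m in auto)
  also have "\<dots> = (\<Sum>l<m. if R (c i) l then real (s l) * y l else 0)"
  proof (intro sum.cong refl)
    fix l
    have "{j \<in> parcs G `` {i}. c j = l} = (if R (c i) l then {u \<in> pverts G. c u = l} else {})"
      unfolding nb by auto
    then show "(\<Sum>j\<in>{j \<in> parcs G `` {i}. c j = l}. y (c j)) = (if R (c i) l then real (s l) * y l else 0)"
      using G(2) by (simp add: blow_up_def)
  qed
  finally show ?thesis .
qed

text \<open>
  The extremal graphs are blow-ups of one pattern: classes \<open>0\<close> and \<open>2\<close> hold the ends of the deleted edge,
  classes \<open>1\<close> and \<open>3\<close> the other vertices of the two parts, and class \<open>4\<close> the pendant vertex. Unused classes are
  empty; a complete bipartite graph has the classes \<open>1\<close> and \<open>3\<close> only.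
\<close>

definition extremal_pattern :: "nat \<Rightarrow> nat \<Rightarrow> bool" where
  "extremal_pattern k l \<longleftrightarrow> (k, l) \<in> {(0,3), (3,0), (0,4), (4,0), (1,2), (2,1), (1,3), (3,1)}"

definition pattern_sizes :: "nat \<Rightarrow> nat \<Rightarrow> nat \<Rightarrow> nat \<Rightarrow> nat \<Rightarrow> nat \<Rightarrow> nat" where
  "pattern_sizes a b c d e l =
    (if l = 0 then a else if l = 1 then b else if l = 2 then c else if l = 3 then d
     else if l = 4 then e else 0)"

text \<open>One labelling serves both \<open>near_complete_graph\<close> and
  \<open>pendant_graph\<close>: label \<open>4\<close> occurs only at the added vertex
  \<open>2 * \<Delta>\<close> of the latter.\<close>

definition extremal_label :: "nat \<Rightarrow> nat \<Rightarrow> nat" where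
  "extremal_label \<Delta> i =
    (if i = 0 then 0 else if i < \<Delta> then 1 else if i = \<Delta> then 2 else if i < 2 * \<Delta> then 3 else 4)"

lemma extremal_label_le: "extremal_label \<Delta> i \<le> 4"
  by (simp add: extremal_label_def)

text \<open>The last branch is the pendant class \<open>4\<close>, whose neighbours all lie in class
  \<open>0\<close>.\<close>

lemma blow_up_sum_extremal:
  fixes y :: "nat \<Rightarrow> real"
  assumes "pair_graph G" "blow_up extremal_pattern s c G" "i \<in> pverts G"
    and m: "\<And>u. u \<in> pverts G \<Longrightarrow> c u \<le> 4"
  shows "(\<Sum>j\<in>parcs G `` {i}. y (c j)) =
    (if c i = 0 then s 3 * y 3 + s 4 * y 4
     else if c i = 1 then s 2 * y 2 + s 3 * y 3
     else if c i = 2 then s 1 * y 1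
     else if c i = 3 then s 0 * y 0 + s 1 * y 1
     else s 0 * y 0)"
proof -
  let ?h = "\<lambda>l. if extremal_pattern (c i) l then real (s l) * y l else 0"
  have "(\<Sum>j\<in>parcs G `` {i}. y (c j)) = (\<Sum>l<5. ?h l)"
    using m by (intro blow_up_sum_neighbours[OF assms(1-3)]) (fastforce simp: le_imp_less_Suc)
  also have "{..<5} = {0, 1, 2, 3, 4 :: nat}" by auto
  also have "sum ?h {0, 1, 2, 3, 4} = ?h 0 + ?h 1 + ?h 2 + ?h 3 + ?h 4" by simp
  finally have "(\<Sum>j\<in>parcs G `` {i}. y (c j)) = ?h 0 + ?h 1 + ?h 2 + ?h 3 + ?h 4" .
  moreover have "c i = 0 \<or> c i = 1 \<or> c i = 2 \<or> c i = 3 \<or> c i = 4" using m[OF assms(3)] by linarith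
  ultimately show ?thesis by (elim disjE) (simp_all add: extremal_pattern_def)
qed

section \<open>The three kinds of extremal graphs and their spectral radii\<close>

lemma pair_graph_complete_bipartite: "pair_graph (complete_bipartite_graph p q)"
  by (rule pair_graphI) (auto simp: complete_bipartite_graph_def sym_def irrefl_def)

lemma blow_up_complete_bipartite:
  "blow_up extremal_pattern (pattern_sizes 0 p 0 q 0) (\<lambda>i. if i < p then 1 else 3)
    (complete_bipartite_graph p q)"
proof -
  have "card {u \<in> {..<p + q}. (if u < p then 1 else 3) = l} = pattern_sizes 0 p 0 q 0 l" for l
  proof -
    have "{u \<in> {..<p + q}. (if u < p then 1 else 3) = l} =
        (if l = 1 then {..<p} else if l = 3 then {p..<p + q} else {})" by auto
    then show ?thesis unfolding pattern_sizes_def by simp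
  qed
  moreover have "(u, v) \<in> parcs (complete_bipartite_graph p q) \<longleftrightarrow>
      extremal_pattern (if u < p then 1 else 3) (if v < p then 1 else 3)" if "u < p + q" "v < p + q" for u v
    using that by (cases "u < p"; cases "v < p")
      (simp_all add: complete_bipartite_graph_def extremal_pattern_def)
  ultimately show ?thesis unfolding blow_up_def by (simp add: complete_bipartite_graph_def)
qed

lemma spectral_radius_complete_bipartite:
  assumes "0 < p" "0 < q"
  shows "graph_spectral_radius (complete_bipartite_graph p q) = sqrt (real p * real q)"
proof (rule graph_spectral_radius_eqI[OF pair_graph_complete_bipartite])
  let ?c = "\<lambda>i::nat. if i < p then 1 else 3 :: nat"
  \<comment> \<open>Each part gets the square root of the size of the other: \<open>q\<close>
    neighbours of weight \<open>sqrt p\<close> sum to \<open>sqrt (p * q) * sqrt q\<close>.\<close>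
  let ?y = "\<lambda>l::nat. if l = 1 then sqrt q else sqrt p"
  show "pverts (complete_bipartite_graph p q) \<noteq> {}" using assms by (auto simp: complete_bipartite_graph_def)
  fix i assume i: "i \<in> pverts (complete_bipartite_graph p q)"
  show "0 < ?y (?c i)" using assms by auto
  show "(\<Sum>j\<in>parcs (complete_bipartite_graph p q) `` {i}. ?y (?c j)) = sqrt (real p * real q) * ?y (?c i)"
    using blow_up_sum_extremal[OF pair_graph_complete_bipartite blow_up_complete_bipartite i, of ?y]
    by (simp add: pattern_sizes_def real_sqrt_mult split: if_splits)
qed

definition near_complete_graph :: "nat \<Rightarrow> nat pair_pre_digraph" where
  "near_complete_graph \<Delta> = delete_edge 0 \<Delta> (complete_bipartite_graph \<Delta> \<Delta>)"

lemma pair_graph_near_complete: "pair_graph (near_complete_graph \<Delta>)"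
  by (rule pair_graphI) (auto simp: near_complete_graph_def delete_edge_def complete_bipartite_graph_def sym_def irrefl_def)

lemma extremal_label_class:
  assumes "0 < d"
  shows "{u \<in> {..<2 * Suc d}. extremal_label (Suc d) u = l} =
    (if l = 0 then {0} else if l = 1 then {1..<Suc d} else if l = 2 then {Suc d}
     else if l = 3 then {Suc (Suc d)..<2 * Suc d} else {})"
  using assms by (auto simp: extremal_label_def split: if_splits)

lemma blow_up_near_complete:
  assumes "0 < d"
  shows "blow_up extremal_pattern (pattern_sizes 1 d 1 d 0) (extremal_label (Suc d)) (near_complete_graph (Suc d))"
proof -
  have "card {u \<in> {..<2 * Suc d}. extremal_label (Suc d) u = l} = pattern_sizes 1 d 1 d 0 l" for l
    unfolding extremal_label_class[OF assms] pattern_sizes_def by simp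
  moreover have "(u, v) \<in> parcs (near_complete_graph (Suc d)) \<longleftrightarrow>
      extremal_pattern (extremal_label (Suc d) u) (extremal_label (Suc d) v)"
    if "u < 2 * Suc d" "v < 2 * Suc d" for u v
    using that assms
    by (cases "u = 0"; cases "v = 0"; cases u "Suc d" rule: linorder_cases; cases v "Suc d" rule: linorder_cases)
      (simp_all add: near_complete_graph_def delete_edge_def complete_bipartite_graph_def
        extremal_pattern_def extremal_label_def)
  ultimately show ?thesis
    unfolding blow_up_def
    by (simp add: near_complete_graph_def delete_edge_def complete_bipartite_graph_def mult_2)
qed

text \<open>With \<open>d\<close> on the ends of the deleted edge and \<open>r\<close> elsewhere,
  the equations at the ends are identities and all others read
  \<open>r * r = d * r + d\<close>.\<close>

lemma spectral_radius_near_complete: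
  assumes d: "0 < d" and r: "0 < r" "r * r = real d * (r + 1)"
  shows "graph_spectral_radius (near_complete_graph (Suc d)) = r"
proof (rule graph_spectral_radius_eqI[OF pair_graph_near_complete])
  let ?c = "extremal_label (Suc d)" and ?G = "near_complete_graph (Suc d)"
  let ?y = "\<lambda>l::nat. if l = 0 \<or> l = 2 then real d else r"
  show "pverts ?G \<noteq> {}"
    by (auto simp: near_complete_graph_def delete_edge_def complete_bipartite_graph_def)
  fix i assume i: "i \<in> pverts ?G"
  show "0 < ?y (?c i)" using assms by auto
  have c: "?c u \<in> {0, 1, 2, 3}" if "u \<in> pverts ?G" for u
    using that by (auto simp: near_complete_graph_def delete_edge_def complete_bipartite_graph_def extremal_label_def)
  show "(\<Sum>j\<in>parcs ?G `` {i}. ?y (?c j)) = r * ?y (?c i)"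
    using c[OF i] r(2) blow_up_sum_extremal[OF pair_graph_near_complete blow_up_near_complete[OF d] i, of ?y]
    by (auto simp: pattern_sizes_def algebra_simps extremal_label_le)
qed

definition pendant_graph :: "nat \<Rightarrow> nat pair_pre_digraph" where
  "pendant_graph \<Delta> = add_pendant (2 * \<Delta>) 0 (near_complete_graph \<Delta>)"

lemma pair_graph_pendant: "0 < \<Delta> \<Longrightarrow> pair_graph (pendant_graph \<Delta>)"
  by (rule pair_graphI) (auto simp: pendant_graph_def add_pendant_def near_complete_graph_def delete_edge_def
      complete_bipartite_graph_def sym_def irrefl_def)

lemma blow_up_pendant:
  assumes "0 < d"
  shows "blow_up extremal_pattern (pattern_sizes 1 d 1 d 1) (extremal_label (Suc d)) (pendant_graph (Suc d))"
proof -
  have "card {u \<in> insert (2 * Suc d) {..<2 * Suc d}. extremal_label (Suc d) u = l} = pattern_sizes 1 d 1 d 1 l" for l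
  proof -
    have "{u \<in> insert (2 * Suc d) {..<2 * Suc d}. extremal_label (Suc d) u = l} =
      (if l = 4 then {2 * Suc d} else {}) \<union> {u \<in> {..<2 * Suc d}. extremal_label (Suc d) u = l}"
      by (auto simp: extremal_label_def)
    then show ?thesis unfolding extremal_label_class[OF assms] pattern_sizes_def by simp
  qed
  moreover have "(u, v) \<in> parcs (pendant_graph (Suc d)) \<longleftrightarrow>
      extremal_pattern (extremal_label (Suc d) u) (extremal_label (Suc d) v)"
    if uv: "u \<le> 2 * Suc d" "v \<le> 2 * Suc d" for u v
  proof -
    have near: "(u, v) \<in> parcs (near_complete_graph (Suc d)) \<longleftrightarrow>
        extremal_pattern (extremal_label (Suc d) u) (extremal_label (Suc d) v)"
      if "u < 2 * Suc d" "v < 2 * Suc d"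
      using blow_up_near_complete[OF assms] that
      by (simp add: blow_up_def near_complete_graph_def delete_edge_def complete_bipartite_graph_def mult_2)
    have last: "extremal_label (Suc d) (2 * Suc d) = 4" by (simp add: extremal_label_def)
    have only_0: "extremal_pattern k 4 \<longleftrightarrow> k = 0" "extremal_pattern 4 k \<longleftrightarrow> k = 0" for k
      by (auto simp: extremal_pattern_def)
    have lab_0: "extremal_label (Suc d) w = 0 \<longleftrightarrow> w = 0" for w by (simp add: extremal_label_def)
    have arcs: "(u, v) \<in> parcs (pendant_graph (Suc d)) \<longleftrightarrow>
      (u, v) \<in> parcs (near_complete_graph (Suc d)) \<or> (u, v) = (2 * Suc d, 0) \<or> (u, v) = (0, 2 * Suc d)"
      by (auto simp: pendant_graph_def add_pendant_def)
    have lt: "u < 2 * Suc d \<and> v < 2 * Suc d" if "(u, v) \<in> parcs (near_complete_graph (Suc d))"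
      using that by (auto simp: near_complete_graph_def delete_edge_def complete_bipartite_graph_def)
    consider "u < 2 * Suc d" "v < 2 * Suc d" | "u = 2 * Suc d" | "v = 2 * Suc d"
      using uv by linarith
    then show ?thesis
    proof cases
      case 1
      then show ?thesis using near arcs by auto
    next
      case 2
      then have "(u, v) \<in> parcs (pendant_graph (Suc d)) \<longleftrightarrow> v = 0" using arcs lt by auto
      then show ?thesis unfolding 2 last only_0 lab_0 .
    next
      case 3
      then have "(u, v) \<in> parcs (pendant_graph (Suc d)) \<longleftrightarrow> u = 0" using arcs lt by auto
      then show ?thesis unfolding 3 last only_0 lab_0 .
    qed
  qed
  moreover have "pverts (pendant_graph (Suc d)) = insert (2 * Suc d) {..<2 * Suc d}"
    by (simp add: pendant_graph_def add_pendant_def near_complete_graph_def delete_edge_def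
        complete_bipartite_graph_def mult_2)
  ultimately show ?thesis unfolding blow_up_def by auto
qed

text \<open>The vector of the overview for fibres of sizes \<open>1\<close> and \<open>d\<close>:
  \<open>r\<close> is the squared radius, class \<open>0\<close> alone misses the vertex of class
  \<open>2\<close>, and class \<open>1\<close> misses the pendant vertex. The equation for
  \<open>r\<close> says that the values on the first part sum to \<open>1 / d\<close>.\<close>

lemma spectral_radius_pendant:
  assumes d: "0 < d" and r: "real d < r" "1 < r" "real d * (real d / (r - d) + 1 / (r - 1)) = 1"
  shows "graph_spectral_radius (pendant_graph (Suc d)) = sqrt r"
proof (rule graph_spectral_radius_eqI[OF pair_graph_pendant])
  let ?c = "extremal_label (Suc d)" and ?G = "pendant_graph (Suc d)"
  define y where "y l = (if l = 0 then 1 / (r - 1) else if l = 1 then 1 / (r - d)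
    else if l = 2 then d / (r - d) / sqrt r else if l = 3 then 1 / d / sqrt r else 1 / (r - 1) / sqrt r)" for l :: nat
  show "pverts ?G \<noteq> {}" by (auto simp: pendant_graph_def add_pendant_def)
  fix i assume i: "i \<in> pverts ?G"
  show "0 < y (?c i)" using assms by (auto simp: y_def)
  have c: "?c i \<in> {0, 1, 2, 3, 4}" by (auto simp: extremal_label_def)
  have rr: "sqrt r * sqrt r = r" using r by simp
  have sum: "d / (r - d) + 1 / (r - 1) = 1 / d" using r(3) d by (simp add: field_simps)
  have "d * y 3 + y 4 = sqrt r * y 0" "y 2 + d * y 3 = sqrt r * y 1" "d * y 1 = sqrt r * y 2"
    "y 0 + d * y 1 = sqrt r * y 3" "y 0 = sqrt r * y 4"
    using r d sum by (auto simp: y_def field_simps rr)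
  then show "(\<Sum>j\<in>parcs ?G `` {i}. y (?c j)) = sqrt r * y (?c i)"
    using c blow_up_sum_extremal[OF pair_graph_pendant blow_up_pendant[OF d] i, of y]
    by (auto simp: pattern_sizes_def extremal_label_le)
qed simp

lemma extremal_graph_cases:
  "2 * \<Delta> > n \<Longrightarrow> extremal_graph n \<Delta> = complete_bipartite_graph \<Delta> (n - \<Delta>)"
  "2 * \<Delta> = n \<Longrightarrow> extremal_graph n \<Delta> = near_complete_graph \<Delta>"
  "2 * \<Delta> + 1 = n \<Longrightarrow> extremal_graph n \<Delta> = pendant_graph \<Delta>"
  by (auto simp: extremal_graph_def near_complete_graph_def pendant_graph_def)

text \<open>Clearing denominators gives the quadratic \<open>?p\<close>, negative at
  \<open>d * (d + 1)\<close> and positive at \<open>(d + 1)^2\<close>. For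
  \<open>\<Delta> = d + 1\<close> the lower bound is \<open>\<Delta> * (\<Delta> - 1)\<close>, as
  \<open>dominated_unbalanced\<close> requires.\<close>

lemma pendant_radius_exists:
  assumes "0 < d"
  obtains r where "real d * (real d + 1) < r" "real d * (real d / (r - d) + 1 / (r - 1)) = 1"
proof -
  let ?p = "\<lambda>x::real. x^2 - (d+1)^2 * x + d * (2 * d + 1)"
  let ?a = "real d * (real d + 1)" and ?b = "(real d + 1)^2"
  have "?p ?a = - (real d ^ 3)" by (simp add: power2_eq_square power3_eq_cube algebra_simps)
  then have a: "?p ?a < 0" using assms by simp
  have "?p ?b = real d * (2 * real d + 1)" by (simp add: power2_eq_square algebra_simps)
  then have b: "?p ?b > 0" using assms by simp
  have "?a \<le> ?b" by (simp add: power2_eq_square algebra_simps)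
  then obtain r where r: "?a \<le> r" "?p r = 0"
    using IVT'[of ?p ?a 0 ?b] a b by (force intro!: continuous_intros)
  then have ar: "?a < r" using a by (cases "r = ?a") auto
  have "1 * (real d + 1) \<le> ?a" using assms by (intro mult_right_mono) auto
  also note ar
  finally have "real d + 1 < r" by simp
  moreover have "0 < real d" using assms by simp
  ultimately have gt: "real d < r" "1 < r" by linarith+
  have "real d * (real d / (r - d) + 1 / (r - 1)) = real d * (d * (r - 1) + (r - d)) / ((r - d) * (r - 1))"
    using gt by (simp add: add_frac_eq)
  also have "real d * (d * (r - 1) + (r - d)) = (r - d) * (r - 1)"
    using r(2) by (simp add: power2_eq_square algebra_simps)
  also have "(r - d) * (r - 1) / ((r - d) * (r - 1)) = 1" using gt by simp
  finally have "real d * (real d / (r - d) + 1 / (r - 1)) = 1" .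
  then show ?thesis using that ar by blast
qed

text \<open>\<open>r\<close> is the larger root of \<open>x * x - d * x - d\<close>. From
  \<open>d < r\<close>, its square \<open>d * (r + 1)\<close> exceeds \<open>d * (d + 1)\<close>,
  which settles the unbalanced case.\<close>

lemma near_complete_radius_exists:
  assumes "0 < d"
  obtains r where "real d < r" "r * r = real d * (r + 1)"
proof -
  let ?r = "(real d + sqrt (d * d + 4 * d)) / 2"
  have s: "sqrt (real d * d + 4 * d) * sqrt (real d * d + 4 * d) = real d * d + 4 * d" by simp
  have "sqrt (real d * d) < sqrt (real d * d + 4 * d)" using assms by (intro real_sqrt_less_mono) auto
  then have "real d < ?r" by simp
  moreover have "?r * ?r = real d * (?r + 1)" using s by (simp add: field_simps)
  ultimately show ?thesis using that by blast
qed

section \<open>The fibre inequality\<close>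

text \<open>Two fibres cover \<open>d + 1\<close> points. As \<open>x / (r - x)\<close> is convex,
  the sum is largest at the most uneven split; the factor \<open>(x - 1) * (d - x)\<close> in
  \<open>key\<close> makes this explicit and settles equality.\<close>

lemma merge_fibres:
  fixes r :: real
  assumes m: "1 \<le> m" "m \<le> d" and r: "real d + 1 < r"
  shows "m / (r - m) + (Suc d - m) / (r - (Suc d - m)) \<le> d / (r - d) + 1 / (r - 1)"
    and "m / (r - m) + (Suc d - m) / (r - (Suc d - m)) = d / (r - d) + 1 / (r - 1) \<Longrightarrow> m = 1 \<or> m = d"
proof -
  define x where "x = real m"
  have x: "1 \<le> x" "x \<le> d" and md: "real (Suc d - m) = d + 1 - x" using m by (auto simp: x_def of_nat_diff)
  have key: "d / (r - d) + 1 / (r - 1) - (x / (r - x) + (d + 1 - x) / (r - (d + 1 - x)))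
    = r * (2 * r - d - 1) * ((x - 1) * (d - x)) / ((r - d) * (r - 1) * ((r - x) * (r - (d + 1 - x))))"
    using x r by (simp add: divide_simps) (simp add: algebra_simps)
  have pos: "0 < r * (2 * r - d - 1)" "0 < (r - d) * (r - 1) * ((r - x) * (r - (d + 1 - x)))"
    using x r by (auto intro!: mult_pos_pos)
  show "m / (r - m) + (Suc d - m) / (r - (Suc d - m)) \<le> d / (r - d) + 1 / (r - 1)"
    using key pos x unfolding md x_def[symmetric]
    by (metis diff_ge_0_iff_ge divide_nonneg_pos mult_nonneg_nonneg less_imp_le)
  assume "m / (r - m) + (Suc d - m) / (r - (Suc d - m)) = d / (r - d) + 1 / (r - 1)"
  then have "r * (2 * r - d - 1) * ((x - 1) * (d - x)) / ((r - d) * (r - 1) * ((r - x) * (r - (d + 1 - x)))) = 0"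
    unfolding md x_def[symmetric] key[symmetric] by simp
  then have "r * (2 * r - d - 1) * ((x - 1) * (d - x)) = 0" using pos(2) by (metis divide_eq_0_iff less_irrefl)
  then have "(x - 1) * (d - x) = 0" using pos(1) by (metis mult_eq_0_iff less_irrefl)
  then show "m = 1 \<or> m = d" by (auto simp: x_def)
qed

text \<open>Turns equality of the neighbour sums of a positive vector into equality of
  neighbourhoods.\<close>

lemma sum_eq_imp_eq:
  fixes f :: "'a \<Rightarrow> real"
  assumes "finite B" "A \<subseteq> B" "\<And>x. x \<in> B \<Longrightarrow> 0 < f x" "sum f B \<le> sum f A"
  shows "A = B"
proof (rule ccontr)
  assume "A \<noteq> B"
  then obtain b where "b \<in> B - A" using assms(2) by blast
  then have "sum f A < sum f B" using assms by (intro sum_strict_mono2[of B A b]) (auto simp: less_imp_le)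
  then show False using assms(4) by simp
qed

text \<open>Cut \<open>U\<close> into one fibre \<open>T\<close> and the rest \<open>R\<close>. A
  fibre inside \<open>R\<close> has at most |R| points, so counting \<open>R\<close> as a single
  fibre only increases the sum, and \<open>merge_fibres\<close> applies. Equality forces
  \<open>R\<close> to be one fibre and \<open>T\<close> or \<open>R\<close> to be a single
  point.\<close>

lemma fibre_sum_le:
  fixes f :: "'a \<Rightarrow> 'b" and r :: real
  defines "c \<equiv> \<lambda>v U. card {u \<in> U. f u = v}"
  assumes U: "finite U" "card U = Suc d" and d: "0 < d" and r: "real d + 1 < r"
    and nonconst: "\<And>v. c v U \<le> d"
  shows "(\<Sum>u\<in>U. 1 / (r - c (f u) U)) \<le> d / (r - d) + 1 / (r - 1)"
    and "(\<Sum>u\<in>U. 1 / (r - c (f u) U)) = d / (r - d) + 1 / (r - 1) \<Longrightarrow>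
      \<exists>a\<in>U. \<exists>w. w \<noteq> f a \<and> (\<forall>u\<in>U - {a}. f u = w)"
proof -
  let ?y = "\<lambda>u. 1 / (r - c (f u) U)"
  obtain u1 where u1: "u1 \<in> U" using U by fastforce
  define T where "T = {u \<in> U. f u = f u1}"
  define R where "R = U - T"
  define m where "m = card T"
  have fin: "finite T" "finite R" using U by (auto simp: T_def R_def)
  have TU: "T \<subseteq> U" by (auto simp: T_def)
  have cardR: "card R = Suc d - m"
    using card_Diff_subset[OF fin(1) TU] U by (simp add: R_def m_def)
  have "T \<noteq> {}" using u1 by (auto simp: T_def)
  then have m: "1 \<le> m" "m \<le> d"
    using fin nonconst[of "f u1"] by (auto simp: m_def c_def T_def Suc_le_eq card_gt_0_iff)
  have fibR: "{w \<in> U. f w = f u} \<subseteq> R" if "u \<in> R" for u using that by (auto simp: R_def T_def)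
  have cR: "c (f u) U \<le> Suc d - m" if "u \<in> R" for u
    unfolding c_def cardR[symmetric] by (rule card_mono[OF fin(2) fibR[OF that]])
  have yR: "?y u \<le> 1 / (r - (Suc d - m))" if "u \<in> R" for u
    using cR[OF that] r m by (intro divide_left_mono mult_pos_pos) (auto simp: of_nat_diff)
  have split: "sum ?y U = m / (r - m) + sum ?y R"
  proof -
    have "sum ?y U = sum ?y T + sum ?y R"
      unfolding R_def using U TU by (simp add: sum.subset_diff)
    moreover have "sum ?y T = (\<Sum>u\<in>T. 1 / (r - m))"
      by (intro sum.cong) (auto simp: m_def T_def c_def)
    ultimately show ?thesis by (simp add: m_def)
  qed
  have sumR: "sum ?y R \<le> (Suc d - m) / (r - (Suc d - m))"
    using sum_mono[of R ?y "\<lambda>_. 1 / (r - (Suc d - m))"] yR cardR by simp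
  note merge = merge_fibres[OF m r]
  show "sum ?y U \<le> d / (r - d) + 1 / (r - 1)" using split sumR merge(1) by linarith
  assume eq: "sum ?y U = d / (r - d) + 1 / (r - 1)"
  then have eqR: "sum ?y R = (Suc d - m) / (r - (Suc d - m))"
    and "m / (r - m) + (Suc d - m) / (r - (Suc d - m)) = d / (r - d) + 1 / (r - 1)"
    using split sumR merge(1) by linarith+
  then have m1d: "m = 1 \<or> m = d" using merge(2) by blast
  have "R \<noteq> {}" using cardR m by (metis card.empty diff_is_0_eq le_imp_less_Suc not_le)
  then obtain u2 where u2: "u2 \<in> R" by blast
  \<comment> \<open>A smaller fibre would make the estimate on \<open>R\<close> strict.\<close>
  have "c (f u2) U = Suc d - m"
  proof (rule ccontr)
    assume "c (f u2) U \<noteq> Suc d - m"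
    then have "c (f u2) U < Suc d - m" using cR[OF u2] by simp
    then have "?y u2 < 1 / (r - (Suc d - m))"
      using r m by (intro divide_strict_left_mono mult_pos_pos) (auto simp: of_nat_diff)
    then have "sum ?y R < (\<Sum>u\<in>R. 1 / (r - (Suc d - m)))"
      using fin(2) u2 yR by (intro sum_strict_mono_ex1) blast+
    then show False using eqR cardR by simp
  qed
  then have "{w \<in> U. f w = f u2} = R"
    using card_subset_eq[OF fin(2) fibR[OF u2]] cardR by (simp add: c_def)
  then have R: "f u = f u2" if "u \<in> R" for u using that by blast
  have T: "f u = f u1" if "u \<in> T" for u using that by (simp add: T_def)
  have ne: "f u2 \<noteq> f u1" using u2 by (auto simp: R_def T_def)
  have UTR: "u \<in> T \<or> u \<in> R" if "u \<in> U" for u using that by (auto simp: R_def)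
  \<comment> \<open>\<open>a\<close> is the point of whichever of \<open>T\<close> and
    \<open>R\<close> is a singleton, and \<open>w\<close> is the value of \<open>f\<close> on the
    other.\<close>
  from m1d show "\<exists>a\<in>U. \<exists>w. w \<noteq> f a \<and> (\<forall>u\<in>U - {a}. f u = w)"
  proof
    assume "m = 1"
    then obtain a where a: "T = {a}" by (auto simp: m_def card_1_singleton_iff)
    then have "u1 = a" using u1 by (auto simp: T_def)
    then have "\<forall>u\<in>U - {u1}. f u = f u2" using UTR R a by blast
    then show ?thesis using u1 ne by blast
  next
    assume "m = d"
    then obtain a where a: "R = {a}" using cardR by (auto simp: card_1_singleton_iff)
    then have "u2 = a" using u2 by blast
    then have "\<forall>u\<in>U - {u2}. f u = f u1" using UTR T a by blast
    then show ?thesis using u2 ne by (intro bexI[of _ u2] exI[of _ "f u1"]) (auto simp: R_def)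
  qed
qed

section \<open>Comparison with the extremal graph\<close>

definition spectrally_dominated :: "'a pair_pre_digraph \<Rightarrow> 'b pair_pre_digraph \<Rightarrow> bool" where
  "spectrally_dominated G H \<longleftrightarrow> graph_spectral_radius G \<le> graph_spectral_radius H \<and>
    (graph_spectral_radius G = graph_spectral_radius H \<longleftrightarrow> digraph_iso (with_proj G) (with_proj H))"

text \<open>Letting \<open>U\<close> be the smaller part costs no generality, since the parts can be
  exchanged.\<close>

locale connected_irregular_bipartite = pair_graph G for G :: "'a pair_pre_digraph" +
  fixes U V :: "'a set" and \<Delta> :: nat
  assumes parts: "pverts G = U \<union> V" "U \<inter> V = {}" "parcs G \<subseteq> U \<times> V \<union> V \<times> U"
    and part_le: "card U \<le> card V"
    and connected: "Digraph_Component.connected (with_proj G)"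
    and irregular: "irregular G"
    and max_degree: "max_degree G = \<Delta>"
begin

section \<open>Elementary bounds on degrees and part sizes\<close>

abbreviation nb :: "'a \<Rightarrow> 'a set" where "nb i \<equiv> parcs G `` {i}"

lemma finite_parts: "finite U" "finite V"
  using parts pair_finite_verts by simp_all

lemma nb_U: "u \<in> U \<Longrightarrow> nb u \<subseteq> V" and nb_V: "v \<in> V \<Longrightarrow> nb v \<subseteq> U"
  using parts by blast+

lemma finite_nb: "finite (nb i)"
  by (rule finite_subset[OF _ pair_finite_verts]) (auto dest: arc_snd_in_verts)

lemma arc_sym: "(u, v) \<in> parcs G \<longleftrightarrow> (v, u) \<in> parcs G"
  using pair_graph_arc_sym[OF pair_graph] by blast

lemma degree_le: "i \<in> pverts G \<Longrightarrow> card (nb i) \<le> \<Delta>"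
  unfolding max_degree[symmetric] max_degree_def out_degree_eq_card_Image[symmetric]
  using pair_finite_verts by (intro Max_ge) auto

lemma nb_nonempty:
  assumes "i \<in> pverts G"
  shows "nb i \<noteq> {}"
proof -
  obtain w where "w \<in> pverts G" "w \<noteq> i"
    using irregular unfolding irregular_def by metis
  then show ?thesis using connected_imp_neighbour[OF pair_graph connected assms] by blast
qed

text \<open>Otherwise every vertex, having a neighbour, would have degree exactly 1. Hence
  \<open>d = \<Delta> - 1\<close> is positive below.\<close>

lemma max_degree_ge_2: "2 \<le> \<Delta>"
proof (rule ccontr)
  assume "\<not> 2 \<le> \<Delta>"
  then have "card (nb i) = 1" if "i \<in> pverts G" for i
    using degree_le[OF that] nb_nonempty[OF that] finite_nb[of i] card_gt_0_iff[of "nb i"] by auto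
  then show False using irregular by (simp add: irregular_def out_degree_eq_card_Image)
qed

lemma max_degree_le_card: "\<Delta> \<le> card V"
proof -
  have "pverts G \<noteq> {}" using irregular by (auto simp: irregular_def)
  then have "\<Delta> \<in> (\<lambda>i. card (nb i)) ` pverts G"
    unfolding max_degree[symmetric] max_degree_def out_degree_eq_card_Image[symmetric]
    using pair_finite_verts by (intro Max_in) auto
  then obtain i where "i \<in> U \<union> V" "\<Delta> = card (nb i)" using parts by auto
  then show ?thesis
    using card_mono[OF finite_parts(2) nb_U[of i]] card_mono[OF finite_parts(1) nb_V[of i]] part_le by auto
qed

lemma card_U_pos: "0 < card U"
proof -
  have "V \<noteq> {}" using max_degree_le_card max_degree_ge_2 by auto
  then obtain v where "v \<in> V" by blast
  then have "U \<noteq> {}" using nb_V[of v] nb_nonempty[of v] parts by auto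
  then show ?thesis using finite_parts by (simp add: card_gt_0_iff)
qed

text \<open>With \<open>sqrt p\<close> on \<open>U\<close> and \<open>sqrt q\<close> on
  \<open>V\<close>, the neighbours of \<open>u\<close> sum to at most
  \<open>p * sqrt q = sqrt (p * q) * sqrt p\<close>, and symmetrically on \<open>V\<close>. Equality
  leaves no slack in the degrees, nor between \<open>sqrt (p * q)\<close> and the radius of
  \<open>H\<close>.\<close>

lemma dominated_by_degrees:
  assumes H: "pair_graph H" and pq: "0 < p" "0 < q"
    and U: "\<And>u. u \<in> U \<Longrightarrow> card (nb u) \<le> p" and V: "\<And>v. v \<in> V \<Longrightarrow> card (nb v) \<le> q"
    and le: "sqrt (real p * real q) \<le> graph_spectral_radius H"
    and iso: "sqrt (real p * real q) = graph_spectral_radius H \<Longrightarrow> (\<And>u. u \<in> U \<Longrightarrow> card (nb u) = p) \<Longrightarrow>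
      (\<And>v. v \<in> V \<Longrightarrow> card (nb v) = q) \<Longrightarrow> digraph_iso (with_proj G) (with_proj H)"
  shows "spectrally_dominated G H"
proof -
  let ?r = "graph_spectral_radius H"
  define z where "z i = (if i \<in> U then sqrt p else sqrt q)" for i
  have zV: "z v = sqrt q" if "v \<in> V" for v using that parts by (auto simp: z_def)
  have zU: "z u = sqrt p" if "u \<in> U" for u using that by (simp add: z_def)
  have sumU: "sum z (nb u) = card (nb u) * sqrt q" if "u \<in> U" for u
    using sum.cong[OF refl, of "nb u" z "\<lambda>_. sqrt q"] nb_U[OF that] zV by (simp add: subset_iff)
  have sumV: "sum z (nb v) = card (nb v) * sqrt p" if "v \<in> V" for v
    using sum.cong[OF refl, of "nb v" z "\<lambda>_. sqrt p"] nb_V[OF that] zU by (simp add: subset_iff)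
  have root: "p * sqrt q = sqrt (real p * real q) * sqrt p" "q * sqrt p = sqrt (real p * real q) * sqrt q"
    by (simp_all add: real_sqrt_mult)
  have chainU: "sum z (nb u) \<le> p * sqrt q" "p * sqrt q \<le> ?r * z u" if "u \<in> U" for u
  proof -
    show "sum z (nb u) \<le> p * sqrt q" using U[OF that] pq unfolding sumU[OF that] by simp
    show "p * sqrt q \<le> ?r * z u"
      unfolding zU[OF that] root(1) using le by (rule mult_right_mono) simp
  qed
  have chainV: "sum z (nb v) \<le> q * sqrt p" "q * sqrt p \<le> ?r * z v" if "v \<in> V" for v
  proof -
    show "sum z (nb v) \<le> q * sqrt p" using V[OF that] pq unfolding sumV[OF that] by simp
    show "q * sqrt p \<le> ?r * z v"
      unfolding zV[OF that] root(2) using le by (rule mult_right_mono) simp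
  qed
  show ?thesis
    unfolding spectrally_dominated_def
  proof (rule graph_spectral_radius_comparison[OF pair_graph connected H, of z])
    show "0 < z i" for i using pq by (simp add: z_def)
    show "sum z (nb i) \<le> ?r * z i" if "i \<in> pverts G" for i
      using that chainU[of i] chainV[of i] parts by fastforce
    assume eq: "\<And>i. i \<in> pverts G \<Longrightarrow> sum z (nb i) = ?r * z i"
    obtain u0 where u0: "u0 \<in> U" using card_U_pos by fastforce
    show "digraph_iso (with_proj G) (with_proj H)"
    proof (rule iso)
      have "sqrt (real p * real q) * sqrt p = ?r * sqrt p"
        using chainU[OF u0] eq[of u0] parts u0 unfolding zU[OF u0] root(1) by auto
      then show "sqrt (real p * real q) = ?r" using pq by simp
      show "card (nb u) = p" if "u \<in> U" for u
        using chainU[OF that] eq[of u] parts that pq unfolding sumU[OF that] by auto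
      show "card (nb v) = q" if "v \<in> V" for v
        using chainV[OF that] eq[of v] parts that pq unfolding sumV[OF that] by auto
    qed
  qed
qed

text \<open>Degrees are at most the size of the opposite part, so it remains to compare
  \<open>a * b\<close> with \<open>\<Delta> * (n - \<Delta>)\<close>: the product x (n - x)
  decreases beyond n/2, and |V| \<ge> \<Delta> > n/2.\<close>

lemma dominated_complete_bipartite:
  assumes n: "card (pverts G) = n" "n < 2 * \<Delta>"
  shows "spectrally_dominated G (complete_bipartite_graph \<Delta> (n - \<Delta>))"
proof -
  let ?H = "complete_bipartite_graph \<Delta> (n - \<Delta>)"
  define a b where "a = card U" and "b = card V"
  have n_ab: "n = a + b" using n(1) parts finite_parts by (simp add: card_Un_disjoint a_def b_def)
  have pos: "0 < a" "0 < b" "\<Delta> \<le> b"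
    using card_U_pos part_le max_degree_le_card by (simp_all add: a_def b_def)
  have \<Delta>n: "\<Delta> < n" using n_ab pos by simp
  have rH: "graph_spectral_radius ?H = sqrt (real \<Delta> * real (n - \<Delta>))"
    using \<Delta>n max_degree_ge_2 by (intro spectral_radius_complete_bipartite) auto
  \<comment> \<open>The second factor is positive since
    \<open>n < 2 * \<Delta> \<le> b + \<Delta>\<close>, so the gap vanishes only for
    \<open>b = \<Delta>\<close>.\<close>
  have gap: "real \<Delta> * real (n - \<Delta>) - real b * real a = (real b - \<Delta>) * (real b + \<Delta> - n)"
    using \<Delta>n n_ab by (simp add: of_nat_diff algebra_simps)
  have gap2: "0 < real b + \<Delta> - n" using n pos by linarith
  have "0 \<le> (real b - \<Delta>) * (real b + \<Delta> - n)" using gap2 pos by simp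
  then have le: "real b * real a \<le> real \<Delta> * real (n - \<Delta>)" using gap by linarith
  show ?thesis
  proof (rule dominated_by_degrees[OF pair_graph_complete_bipartite pos(2,1)])
    show "card (nb u) \<le> b" if "u \<in> U" for u using nb_U[OF that] finite_parts by (simp add: b_def card_mono)
    show "card (nb v) \<le> a" if "v \<in> V" for v using nb_V[OF that] finite_parts by (simp add: a_def card_mono)
    show "sqrt (real b * real a) \<le> graph_spectral_radius ?H" using le rH by simp
    assume "sqrt (real b * real a) = graph_spectral_radius ?H"
    then have "(real b - \<Delta>) * (real b + \<Delta> - n) = 0" using gap rH by simp
    then have b: "b = \<Delta>" using gap2 by simp
    then have a: "a = n - \<Delta>" using n_ab by simp
    assume "card (nb u) = b" if "u \<in> U" for u
    then have full: "nb u = V" if "u \<in> U" for u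
      using that nb_U[OF that] finite_parts(2) by (simp add: b_def card_subset_eq)
    have arcs: "(u, v) \<in> parcs G \<longleftrightarrow> u \<in> U \<and> v \<in> V \<or> u \<in> V \<and> v \<in> U" for u v
      using full parts arc_sym by blast
    let ?c = "\<lambda>i. if i \<in> V then 1 else 3 :: nat"
    have "card {i \<in> pverts G. ?c i = l} = pattern_sizes 0 \<Delta> 0 (n - \<Delta>) 0 l" for l
    proof -
      have "{i \<in> pverts G. ?c i = l} = (if l = 1 then V else if l = 3 then U else {})"
        using parts by auto
      then show ?thesis using a b by (simp add: pattern_sizes_def a_def b_def)
    qed
    moreover have "(u, v) \<in> parcs G \<longleftrightarrow> extremal_pattern (?c u) (?c v)"
      if "u \<in> pverts G" "v \<in> pverts G" for u v
      unfolding arcs using that parts by (cases "u \<in> V"; cases "v \<in> V") (auto simp: extremal_pattern_def)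
    ultimately have "blow_up extremal_pattern (pattern_sizes 0 \<Delta> 0 (n - \<Delta>) 0) ?c G"
      by (simp add: blow_up_def)
    then show "digraph_iso (with_proj G) (with_proj ?H)"
      by (rule blow_up_iso[OF pair_graph _ pair_graph_complete_bipartite blow_up_complete_bipartite])
  qed
qed

text \<open>Vertices of \<open>V\<close> have at most \<open>\<Delta> - 1\<close> neighbours, so the
  radius of \<open>G\<close> is at most \<open>sqrt (\<Delta> * (\<Delta> - 1))\<close>; as that of
  \<open>H\<close> is strictly larger, the equality case cannot arise.\<close>

lemma dominated_unbalanced:
  assumes H: "pair_graph H" and U: "card U < \<Delta>"
    and less: "sqrt (real \<Delta> * real (\<Delta> - 1)) < graph_spectral_radius H"
  shows "spectrally_dominated G H"
proof (rule dominated_by_degrees[OF H, of \<Delta> "\<Delta> - 1"])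
  show "0 < \<Delta>" "0 < \<Delta> - 1" using max_degree_ge_2 by simp_all
  show "card (nb u) \<le> \<Delta>" if "u \<in> U" for u using degree_le that parts by simp
  show "card (nb v) \<le> \<Delta> - 1" if "v \<in> V" for v
    using card_mono[OF finite_parts(1) nb_V[OF that]] U by simp
qed (use less in auto)

lemma dominated_near_complete:
  assumes n: "card (pverts G) = 2 * \<Delta>"
  shows "spectrally_dominated G (near_complete_graph \<Delta>)"
proof -
  define d where "d = \<Delta> - 1"
  have d: "0 < d" "\<Delta> = Suc d" using max_degree_ge_2 by (auto simp: d_def)
  obtain r where r: "real d < r" "r * r = real d * (r + 1)"
    using near_complete_radius_exists[OF d(1)] by blast
  have rpos: "0 < r" using r(1) by linarith
  have rH: "graph_spectral_radius (near_complete_graph \<Delta>) = r"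
    unfolding d(2) by (rule spectral_radius_near_complete[OF d(1) rpos r(2)])
  have ab: "card U + card V = 2 * \<Delta>" using n parts finite_parts by (simp add: card_Un_disjoint)
  show ?thesis
  proof (cases "card U < \<Delta>")
    case True
    have "real \<Delta> * real (\<Delta> - 1) < r\<^sup>2" using r d by (simp add: power2_eq_square)
    then have "sqrt (real \<Delta> * real (\<Delta> - 1)) < r" using rpos by (intro real_less_lsqrt) auto
    then show ?thesis using dominated_unbalanced[OF pair_graph_near_complete True] rH by simp
  next
    case False
    then have cards: "card U = \<Delta>" "card V = \<Delta>" using ab part_le by linarith+
    \<comment> \<open>A complete bipartite graph with both parts of size \<open>\<Delta>\<close>
      would be regular.\<close>
    have "\<exists>u0\<in>U. \<exists>v0\<in>V. (u0, v0) \<notin> parcs G"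
    proof (rule ccontr)
      assume full: "\<not> ?thesis"
      then have "nb u = V" if "u \<in> U" for u using nb_U[OF that] that by blast
      moreover have "nb v = U" if "v \<in> V" for v
        using nb_V[OF that] that full arc_sym by blast
      ultimately have "card (nb i) = \<Delta>" if "i \<in> pverts G" for i using that parts cards by auto
      then show False using irregular by (simp add: irregular_def out_degree_eq_card_Image)
    qed
    then obtain u0 v0 where uv: "u0 \<in> U" "v0 \<in> V" "(u0, v0) \<notin> parcs G" by blast
    define z where "z i = (if i = u0 \<or> i = v0 then real d else r)" for i
    have zpos: "0 < z i" for i using d rpos by (simp add: z_def)
    \<comment> \<open>The neighbourhoods in the complete bipartite graph on \<open>U\<close> and
      \<open>V\<close> without the edge \<open>u0 v0\<close>. \<open>G\<close> is a subgraph of it,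
      and there \<open>z\<close> solves the eigenvalue equation exactly.\<close>
    define full where "full i = (if i = u0 then V - {v0} else if i = v0 then U - {u0} else if i \<in> U then V else U)" for i
    have u0V: "u0 \<notin> V" and v0U: "v0 \<notin> U" and uv0: "u0 \<noteq> v0" using uv parts by auto
    have sumU': "sum z (U - {u0}) = d * r"
    proof -
      have "sum z (U - {u0}) = (\<Sum>i\<in>U - {u0}. r)" using v0U by (intro sum.cong) (auto simp: z_def)
      then show ?thesis using cards uv d by simp
    qed
    have sumV': "sum z (V - {v0}) = d * r"
    proof -
      have "sum z (V - {v0}) = (\<Sum>i\<in>V - {v0}. r)" using u0V by (intro sum.cong) (auto simp: z_def)
      then show ?thesis using cards uv d by simp
    qed
    have sumUV: "sum z U = r * r" "sum z V = r * r"
      using sum.remove[OF finite_parts(1) uv(1), of z] sum.remove[OF finite_parts(2) uv(2), of z]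
        sumU' sumV' r(2) by (simp_all add: z_def algebra_simps)
    have sum_full: "sum z (full i) = r * z i" for i
      using sumUV sumU' sumV' uv0 by (auto simp: full_def z_def)
    have nb_full: "nb i \<subseteq> full i" if "i \<in> pverts G" for i
      using that nb_U[of i] nb_V[of i] uv arc_sym u0V v0U parts(1) by (auto simp: full_def)
    have fin_full: "finite (full i)" for i using finite_parts by (simp add: full_def)
    show ?thesis
      unfolding spectrally_dominated_def
    proof (rule graph_spectral_radius_comparison[OF pair_graph connected pair_graph_near_complete, of z])
      show "sum z (nb i) \<le> graph_spectral_radius (near_complete_graph \<Delta>) * z i" if "i \<in> pverts G" for i
        unfolding rH sum_full[symmetric]
        using nb_full[OF that] fin_full zpos by (intro sum_mono2) (auto simp: less_imp_le)
      assume "\<And>i. i \<in> pverts G \<Longrightarrow> sum z (nb i) = graph_spectral_radius (near_complete_graph \<Delta>) * z i"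
      then have eq: "nb i = full i" if "i \<in> pverts G" for i
        using that nb_full[OF that] zpos unfolding rH sum_full[symmetric]
        by (intro sum_eq_imp_eq[OF fin_full, of _ _ z]) auto
      define c where "c i = (if i = u0 then 0 else if i \<in> U then 1 else if i = v0 then 2 else 3 :: nat)" for i
      have "card {i \<in> pverts G. c i = l} = pattern_sizes 1 d 1 d 0 l" for l
      proof -
        have "{i \<in> pverts G. c i = l} = (if l = 0 then {u0} else if l = 1 then U - {u0}
            else if l = 2 then {v0} else if l = 3 then V - {v0} else {})"
          using parts uv u0V v0U by (auto simp: c_def)
        then show ?thesis using cards uv d by (simp add: pattern_sizes_def)
      qed
      moreover have "(u, v) \<in> parcs G \<longleftrightarrow> extremal_pattern (c u) (c v)"
        if "u \<in> pverts G" "v \<in> pverts G" for u v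
      proof -
        have "(u, v) \<in> parcs G \<longleftrightarrow> v \<in> full u" using eq[OF that(1)] by blast
        moreover have "v \<in> U \<longleftrightarrow> v \<notin> V" using that(2) parts by blast
        ultimately show ?thesis
          using u0V v0U uv(1,2)
          by (cases "u = u0"; cases "v = u0"; cases "u = v0"; cases "v = v0"; cases "u \<in> U"; cases "v \<in> U")
            (simp_all add: full_def c_def extremal_pattern_def)
      qed
      ultimately have "blow_up extremal_pattern (pattern_sizes 1 d 1 d 0) c G" by (simp add: blow_up_def)
      then show "digraph_iso (with_proj G) (with_proj (near_complete_graph \<Delta>))"
        unfolding d(2)
        by (rule blow_up_iso[OF pair_graph _ pair_graph_near_complete blow_up_near_complete[OF d(1)]])
    qed (rule zpos)
  qed
qed

lemma dominated_pendant:
  assumes n: "card (pverts G) = 2 * \<Delta> + 1"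
  shows "spectrally_dominated G (pendant_graph \<Delta>)"
proof -
  define d where "d = \<Delta> - 1"
  have d: "0 < d" "\<Delta> = Suc d" using max_degree_ge_2 by (auto simp: d_def)
  then have rd: "1 \<le> real d" by simp
  obtain r where r: "real d * (real d + 1) < r" "real d * (real d / (r - d) + 1 / (r - 1)) = 1"
    using pendant_radius_exists[OF d(1)] by blast
  have "1 * (real d + 1) \<le> real d * (real d + 1)" using rd by (intro mult_right_mono) auto
  also note r(1)
  finally have dr: "real d + 1 < r" by simp
  then have rpos: "0 < r" "1 < r" "real d < r" using rd by linarith+
  have rH: "graph_spectral_radius (pendant_graph \<Delta>) = sqrt r"
    unfolding d(2) by (rule spectral_radius_pendant[OF d(1) rpos(3,2) r(2)])
  have H: "pair_graph (pendant_graph \<Delta>)" using d by (intro pair_graph_pendant) simp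
  have ab: "card U + card V = 2 * \<Delta> + 1" using n parts finite_parts by (simp add: card_Un_disjoint)
  show ?thesis
  proof (cases "card U < \<Delta>")
    case True
    have "sqrt (real \<Delta> * real (\<Delta> - 1)) < sqrt r" using r(1) d by (simp add: mult.commute add.commute)
    then show ?thesis using dominated_unbalanced[OF H True] rH by simp
  next
    case False
    then have cards: "card U = Suc d" "card V = Suc (Suc d)" using ab part_le d by linarith+
    \<comment> \<open>Degrees are at most \<open>\<Delta>\<close>, while \<open>V\<close> has
      \<open>\<Delta> + 1\<close> vertices.\<close>
    have "\<exists>v. v \<in> V - nb u" if "u \<in> U" for u
    proof -
      have "card (nb u) < card V" using degree_le[of u] that parts cards d by simp
      then have "\<not> V \<subseteq> nb u" using card_mono[OF finite_nb, of V u] by linarith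
      then show ?thesis by blast
    qed
    then obtain f where f: "f u \<in> V - nb u" if "u \<in> U" for u by metis
    define c where "c v = card {u \<in> U. f u = v}" for v
    \<comment> \<open>A fibre equal to all of \<open>U\<close> would isolate
      \<open>v\<close>.\<close>
    have c_le: "c v \<le> d" for v
    proof (rule ccontr)
      assume "\<not> c v \<le> d"
      then have "card U \<le> card {u \<in> U. f u = v}" using cards by (simp add: c_def)
      then have all: "{u \<in> U. f u = v} = U" using finite_parts by (intro card_seteq) auto
      obtain u where u: "u \<in> U" using card_U_pos by fastforce
      have fv: "f w = v" if "w \<in> U" for w using all that by blast
      have v: "v \<in> V" using f[OF u] fv[OF u] by blast
      have "u \<notin> nb v" for u
      proof
        assume u: "u \<in> nb v"
        then have "u \<in> U" using nb_V[OF v] by blast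
        then have "v \<notin> nb u" using f[of u] fv[of u] by blast
        then show False using u arc_sym by blast
      qed
      then have "nb v = {}" by blast
      then show False using nb_nonempty v parts by blast
    qed
    then have cr: "0 < r - c v" for v using dr by (smt (verit) of_nat_le_iff)
    \<comment> \<open>With \<open>g\<close> as below, this choice gives
      \<open>r * y u = 1 + g (f u)\<close>. The term \<open>g (f u)\<close> also occurs in the
      neighbour sum at \<open>u\<close> and cancels, which leaves the condition
      \<open>d * S \<le> 1\<close>.\<close>
    define y where "y u = 1 / (r - c (f u))" for u
    define S where "S = sum y U"
    define g where "g v = c v / (r - c v)" for v
    have ypos: "0 < y u" for u using cr by (simp add: y_def)
    have fibre: "sum y {u \<in> U. f u = v} = g v" for v
      by (simp add: y_def g_def c_def)
    have sum_g: "sum g V = S"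
      unfolding S_def fibre[symmetric] using finite_parts f by (intro sum.group) auto
    define z where "z i = (if i \<in> U then y i else (S - g i) / sqrt r)" for i
    have zU: "z u = y u" if "u \<in> U" for u using that by (simp add: z_def)
    have zV: "z v = (S - g v) / sqrt r" if "v \<in> V" for v using that parts by (auto simp: z_def)
    \<comment> \<open>The neighbourhoods in the bipartite graph where each \<open>u\<close> in
      \<open>U\<close> misses \<open>f u\<close> alone; it contains \<open>G\<close>.\<close>
    define full where "full i = (if i \<in> U then V - {f i} else {u \<in> U. f u \<noteq> i})" for i
    have fin_full: "finite (full i)" for i using finite_parts by (simp add: full_def)
    have nb_full: "nb i \<subseteq> full i" if "i \<in> pverts G" for i
    proof (cases "i \<in> U")
      case True
      then show ?thesis using nb_U[OF True] f[OF True] by (auto simp: full_def)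
    next
      case False
      then have i: "i \<in> V" using that parts by blast
      have "u \<in> U \<and> f u \<noteq> i" if u: "u \<in> nb i" for u
      proof -
        have "u \<in> U" using nb_V[OF i] u by blast
        moreover have "i \<in> nb u" using u arc_sym by blast
        ultimately show ?thesis using f[of u] by auto
      qed
      then show ?thesis using False by (auto simp: full_def)
    qed
    have S_minus: "sum y (full v) = S - g v" if "v \<in> V" for v
    proof -
      have vU: "v \<notin> U" using that parts by blast
      have "S = sum y ({u \<in> U. f u = v} \<union> {u \<in> U. f u \<noteq> v})"
        unfolding S_def by (intro sum.cong) auto
      also have "\<dots> = g v + sum y {u \<in> U. f u \<noteq> v}"
        unfolding fibre[symmetric] using finite_parts by (intro sum.union_disjoint) auto
      finally show ?thesis using vU by (simp add: full_def)
    qed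
    have zpos: "0 < z i" if "i \<in> pverts G" for i
    proof (cases "i \<in> U")
      case True
      then show ?thesis using zU ypos by simp
    next
      case False
      then have i: "i \<in> V" using that parts by blast
      \<comment> \<open>A neighbour of \<open>i\<close> keeps \<open>S - g i\<close> from being an
        empty sum.\<close>
      have "full i \<noteq> {}" using nb_full[OF that] nb_nonempty[OF that] by blast
      then have "0 < sum y (full i)" using fin_full ypos by (intro sum_pos)
      then show ?thesis using zV[OF i] S_minus[OF i] rpos by simp
    qed
    have S_le: "d * S \<le> 1" and S_eq: "d * S = 1 \<Longrightarrow> \<exists>a\<in>U. \<exists>w. w \<noteq> f a \<and> (\<forall>u\<in>U - {a}. f u = w)"
    proof -
      \<comment> \<open>The equation for \<open>r\<close> makes the bound of the fibre inequality
        exactly \<open>1 / d\<close>.\<close>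
      have bound: "d / (r - d) + 1 / (r - 1) = 1 / d" using r(2) rd by (simp add: field_simps)
      note fib = fibre_sum_le[OF finite_parts(1) cards(1) d(1) dr c_le[unfolded c_def]]
      show "d * S \<le> 1"
        using fib(1) rd unfolding bound by (simp add: S_def y_def c_def field_simps)
      assume "d * S = 1"
      then have "S = 1 / d" using rd by (simp add: field_simps)
      then show "\<exists>a\<in>U. \<exists>w. w \<noteq> f a \<and> (\<forall>u\<in>U - {a}. f u = w)"
        by (intro fib(2)) (simp add: bound S_def y_def c_def)
    qed
    have full_V: "sum z (full v) = sqrt r * z v" if "v \<in> V" for v
    proof -
      have "v \<notin> U" using that parts by blast
      then have "sum z (full v) = sum y (full v)"
        using zU by (intro sum.cong) (auto simp: full_def)
      then show ?thesis using S_minus[OF that] zV[OF that] rpos by simp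
    qed
    have full_U: "sum z (full u) = (d * S + g (f u)) / sqrt r" if "u \<in> U" for u
    proof -
      have fu: "f u \<in> V" using f that by blast
      have "sum z (full u) = (\<Sum>v\<in>V - {f u}. (S - g v) / sqrt r)"
        using that zV by (intro sum.cong) (auto simp: full_def)
      also have "\<dots> = (\<Sum>v\<in>V - {f u}. S - g v) / sqrt r" by (simp add: sum_divide_distrib)
      \<comment> \<open>\<open>V\<close> without \<open>f u\<close> has \<open>Suc d\<close>
        elements, and \<open>g\<close> sums to \<open>S\<close> over \<open>V\<close>.\<close>
      also have "(\<Sum>v\<in>V - {f u}. S - g v) = Suc d * S - (S - g (f u))"
        using sum.remove[OF finite_parts(2) fu, of g] sum_g cards fu by (simp add: sum_subtractf)
      finally show ?thesis by (simp add: algebra_simps)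
    qed
    have rz_U: "sqrt r * z u = (1 + g (f u)) / sqrt r" if "u \<in> U" for u
    proof -
      have "1 + g (f u) = r * z u" 
        unfolding zU[OF that] y_def g_def using cr[of "f u"] by (simp add: field_simps)
      then show ?thesis using rpos by (simp add: real_div_sqrt flip: times_divide_eq_left)
    qed
    have full_le: "sum z (full i) \<le> sqrt r * z i" if "i \<in> pverts G" for i
    proof (cases "i \<in> U")
      case True
      show ?thesis unfolding full_U[OF True] rz_U[OF True] using S_le rpos by (simp add: divide_right_mono)
    next
      case False
      then show ?thesis using that full_V parts by auto
    qed
    have full_pverts: "full i \<subseteq> pverts G" for i using parts by (auto simp: full_def)
    have nb_le: "sum z (nb i) \<le> sum z (full i)" if "i \<in> pverts G" for i
      using nb_full[OF that] fin_full zpos full_pverts by (intro sum_mono2) (auto simp: less_imp_le subset_iff)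
    show ?thesis
      unfolding spectrally_dominated_def
    proof (rule graph_spectral_radius_comparison[OF pair_graph connected H zpos])
      show "sum z (nb i) \<le> graph_spectral_radius (pendant_graph \<Delta>) * z i" if "i \<in> pverts G" for i
        unfolding rH using nb_le[OF that] full_le[OF that] by linarith
      assume tight: "\<And>i. i \<in> pverts G \<Longrightarrow> sum z (nb i) = graph_spectral_radius (pendant_graph \<Delta>) * z i"
      have eq: "nb i = full i" if "i \<in> pverts G" for i
        using nb_full[OF that] zpos full_pverts tight[OF that] full_le[OF that] unfolding rH
        by (intro sum_eq_imp_eq[OF fin_full, of _ _ z]) (auto simp: subset_iff)
      obtain u where u: "u \<in> U" using card_U_pos by fastforce
      then have "u \<in> pverts G" using parts by simp
      \<comment> \<open>Tightness at a single vertex of \<open>U\<close> already forces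
        \<open>d * S = 1\<close>.\<close>
      then have "(1 + g (f u)) / sqrt r \<le> (d * S + g (f u)) / sqrt r"
        using tight[of u] nb_le[of u] unfolding rH rz_U[OF u] full_U[OF u] by simp
      then have "d * S = 1" using S_le rpos by (simp add: divide_le_cancel)
      then obtain a w where a: "a \<in> U" and w: "w \<noteq> f a" "\<And>u. u \<in> U - {a} \<Longrightarrow> f u = w"
        using S_eq by blast
      have faV: "f a \<in> V" using f a by blast
      have "U - {a} \<noteq> {}" using cards a d finite_parts by (metis card.empty card_Diff_singleton diff_Suc_1 less_irrefl)
      then have wV: "w \<in> V" using w(2) f by blast
      \<comment> \<open>\<open>a\<close> and \<open>f a\<close> are the ends of the deleted edge.
        All other vertices of \<open>U\<close> miss \<open>w\<close>, so \<open>w\<close> is joined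
        to \<open>a\<close> alone and is the pendant vertex.\<close>
      define l where "l i = (if i = a then 0 else if i \<in> U then 1 else if i = f a then 2
        else if i = w then 4 else 3 :: nat)" for i
      have aV: "a \<notin> V" and fU: "f a \<notin> U" and wU: "w \<notin> U" using a faV wV parts by auto
      have "card {i \<in> pverts G. l i = k} = pattern_sizes 1 d 1 d 1 k" for k
      proof -
        have "{i \<in> pverts G. l i = k} = (if k = 0 then {a} else if k = 1 then U - {a}
            else if k = 2 then {f a} else if k = 3 then V - {f a, w} else if k = 4 then {w} else {})"
          using parts a faV wV w(1) aV fU wU by (auto simp: l_def)
        moreover have "card (V - {f a, w}) = d"
          using card_Diff_subset[of "{f a, w}" V] faV wV w(1) cards by auto
        ultimately show ?thesis using cards a by (simp add: pattern_sizes_def)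
      qed
      moreover have "(u, v) \<in> parcs G \<longleftrightarrow> extremal_pattern (l u) (l v)"
        if "u \<in> pverts G" "v \<in> pverts G" for u v
      proof -
        have fu: "f u = (if u = a then f a else w)" if "u \<in> U" for u using w(2) that by auto
        have "(u, v) \<in> parcs G \<longleftrightarrow> v \<in> full u" using eq[OF that(1)] by blast
        moreover have "v \<in> V \<longleftrightarrow> v \<notin> U" using that(2) parts by blast
        ultimately have arc: "(u, v) \<in> parcs G \<longleftrightarrow>
            (if u \<in> U then v \<notin> U \<and> v \<noteq> (if u = a then f a else w)
             else v \<in> U \<and> u \<noteq> (if v = a then f a else w))"
          using fu by (auto simp: full_def)
        show ?thesis
          unfolding arc using a fU wU w(1)
          by (cases "u \<in> U"; cases "v \<in> U"; cases "u = a"; cases "v = a") (simp_all add: l_def extremal_pattern_def)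
      qed
      ultimately have "blow_up extremal_pattern (pattern_sizes 1 d 1 d 1) l G" by (simp add: blow_up_def)
      then show "digraph_iso (with_proj G) (with_proj (pendant_graph \<Delta>))"
        using H unfolding d(2)
        by (rule blow_up_iso[OF pair_graph _ _ blow_up_pendant[OF d(1)]])
    qed
  qed
qed

lemma dominated_extremal:
  assumes "card (pverts G) = n" "n div 2 \<le> \<Delta>"
  shows "spectrally_dominated G (extremal_graph n \<Delta>)"
proof -
  \<comment> \<open>\<open>n div 2 \<le> \<Delta>\<close> means
    \<open>n \<le> 2 * \<Delta> + 1\<close>, so the \<open>undefined\<close> branch of
    \<open>extremal_graph\<close> is never reached.\<close>
  consider "n < 2 * \<Delta>" | "2 * \<Delta> = n" | "2 * \<Delta> + 1 = n" using assms(2) by linarith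
  then show ?thesis
    using dominated_complete_bipartite dominated_near_complete dominated_pendant assms(1)
    by cases (auto simp: extremal_graph_cases)
qed

end

theorem theorem1p6:
  fixes G :: "'a pair_pre_digraph" and n \<Delta> :: nat
  assumes "pair_graph G"
    and "Digraph_Component.connected (with_proj G)"
    and "irregular G"
    and "bipartite G"
    and "card (pverts G) = n"
    and "max_degree G = \<Delta>"
    and "\<Delta> \<ge> n div 2"
  shows "graph_spectral_radius G \<le> graph_spectral_radius (extremal_graph n \<Delta>) \<and>
    (graph_spectral_radius G = graph_spectral_radius (extremal_graph n \<Delta>) \<longleftrightarrow>
      digraph_iso (with_proj G) (with_proj (extremal_graph n \<Delta>)))"
proof -
  obtain U V where UV: "pverts G = U \<union> V" "U \<inter> V = {}" "parcs G \<subseteq> U \<times> V \<union> V \<times> U"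
    using assms(4) by (auto simp: bipartite_def)
  have dominated: "spectrally_dominated G (extremal_graph n \<Delta>)"
    if "pverts G = A \<union> B" "A \<inter> B = {}" "parcs G \<subseteq> A \<times> B \<union> B \<times> A" "card A \<le> card B" for A B
  proof -
    interpret connected_irregular_bipartite G A B \<Delta>
      by (intro connected_irregular_bipartite.intro connected_irregular_bipartite_axioms.intro)
        (use assms that in auto)
    show ?thesis by (rule dominated_extremal[OF assms(5,7)])
  qed
  have "spectrally_dominated G (extremal_graph n \<Delta>)"
  proof (cases "card U \<le> card V")
    case True
    then show ?thesis using dominated UV by blast
  next
    case False
    then show ?thesis using UV by (intro dominated[of V U]) auto
  qed
  then show ?thesis unfolding spectrally_dominated_def .
qed

end
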